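(* Let $T>0$, $\theta>0$, $\sigma\ge0$, $\sigma_0\ge0$, and let $X$ solve $dX_t=-\theta X_t\,dt+\sigma\,dW_t$ on $[0,T]$ with $W$ a standard Brownian motion and $X_0\sim\mathcal N(0,\sigma_0^2)$ independent of $W$. Let $n,d\ge1$ and $0=t_0<t_1<\cdots<t_n=T$. Define $(\omega_i,e_i)_{i\ge1}$ as follows. (a) If $\sigma_0=0$: $(\omega_i)_{i\ge1}$ are the increasingly sorted positive solutions of $\theta\sin(\omega T)+\omega\cos(\omega T)=0$, and $e_i(t)=\big(\frac T2-\frac{\sin(2\omega_iT)}{4\omega_i}\big)^{-1/2}\sin(\omega_it)$. (b) If $\sigma_0>0$: $(\omega_i)_{i\ge1}$ are the increasingly sorted positive solutions of $$\omega\sigma^2\cos(\omega T)+\big(\theta\sigma^2-\theta^2\sigma_0^2-\omega^2\sigma_0^2\big)\sin(\omega T)=0,$$ and $e_i(t)=K_i\big(\omega_i\sigma_0^2\cos(\omega_it)+(\sigma^2-\theta\sigma_0^2)\sin(\omega_it)\big)$, where $K_i>0$ is the normalization constant such that $\|e_i\|_{L^2([0,T])}=1$, that is, $$\frac1{K_i^2}=\frac12\sigma_0^2(\sigma^2-\theta\sigma_0^2)\big(1-\cos(2\omega_iT)\big)+\frac12\sigma_0^4\omega_i^2\Big(T+\frac{\sin(2\omega_iT)}{2\omega_i}\Big)+\frac12(\sigma^2-\theta\sigma_0^2)^2\Big(T-\frac{\sin(2\omega_iT)}{2\omega_i}\Big).$$ For $0\le j<n$ write $h_j=t_{j+1}-t_j$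 and set $$A_j^i=\frac{-\theta}{\theta^2+\omega_i^2}\left(\frac{2e_i(t_{j+1})}{e^{\theta h_j}-e^{-\theta h_j}}-e_i(t_j)\frac{e^{\theta h_j}+e^{-\theta h_j}}{e^{\theta h_j}-e^{-\theta h_j}}\right)+\frac{1}{\theta^2+\omega_i^2}e_i'(t_j),$$ $$B_j^i=\frac{\theta}{\theta^2+\omega_i^2}\left(e_i(t_{j+1})\frac{e^{\theta h_j}+e^{-\theta h_j}}{e^{\theta h_j}-e^{-\theta h_j}}-\frac{2e_i(t_j)}{e^{\theta h_j}-e^{-\theta h_j}}\right)-\frac{1}{\theta^2+\omega_i^2}e_i'(t_{j+1}).$$ Then in both cases, for every $1\le i\le d$, $$\mathbb{E}\Big[\int_0^TX_se_i(s)\,ds\,\Big|\,X_{t_0},\dots,X_{t_n}\Big]=\sum_{j=0}^n\alpha_{ij}X_{t_j}\quad\text{a.s.},$$ with $\alpha_{i0}=A_0^i$, $\alpha_{in}=B_{n-1}^i$ and $\alpha_{ij}=A_j^i+B_{j-1}^i$ for $1\le j<n$ (in these last coefficients the terms involving $e_i'$ cancel). Furthermore, in case (a), $\lim_{t_{j+1}\to t_j}A_j^i=0$ and $\lim_{t_{j-1}\to t_j}B_{j-1}^i=0$, from which the corresponding formula is deduced when some dates in the schedule are equal.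
   Context: The letter $e$ with an exponent and no subscript denotes the exponential function, while $e_i$ denotes the functions defined in the claim, which the paper gives as the Karhunen-Loève eigenfunctions of $X$ (orthonormal eigenfunctions in $L^2([0,T])$ of its covariance operator). The matrix $(\alpha_{ij})_{1\le i\le d,\,0\le j\le n}$ is the matrix of the linear regression of the vector $\big(\int_0^TX_se_i(s)\,ds\big)_{1\le i\le d}$ on $(X_{t_0},\dots,X_{t_n})$. *)

theory Defs
  imports "HOL-Probability.Probability"
begin

(* The centred normal law with standard deviation s; for s = 0 it is the Dirac mass at 0
   (normal_density with s = 0 is identically 0, hence the case distinction). *)
definition centred_normal :: "real \<Rightarrow> real measure" where
  "centred_normal s = (if s = 0 then return borel 0 else density lborel (normal_density 0 s))"

definition brownian_motion_on :: "real \<Rightarrow> 'w measure \<Rightarrow> (real \<Rightarrow> 'w \<Rightarrow> real) \<Rightarrow> bool" where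
  "brownian_motion_on T M W \<longleftrightarrow>
     prob_space M \<and>
     (\<forall>t\<in>{0..T}. W t \<in> borel_measurable M) \<and>
     (AE x in M. W 0 x = 0) \<and>
     (AE x in M. continuous_on {0..T} (\<lambda>t. W t x)) \<and>
     (\<forall>s\<in>{0..T}. \<forall>t\<in>{0..T}. s < t \<longrightarrow>
        distr M borel (\<lambda>x. W t x - W s x) = centred_normal (sqrt (t - s))) \<and>
     (\<forall>(m::nat) s. (\<forall>k\<le>m. s k \<in> {0..T}) \<and> (\<forall>k<m. s k \<le> s (Suc k)) \<longrightarrow>
        prob_space.indep_vars M (\<lambda>_. borel) (\<lambda>k x. W (s (Suc k)) x - W (s k) x) {..<m})"

(* Independence of a random variable Y and the whole process (W t), t in [0,T]. *)
definition indep_of_process ::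
    "real \<Rightarrow> 'w measure \<Rightarrow> ('w \<Rightarrow> real) \<Rightarrow> (real \<Rightarrow> 'w \<Rightarrow> real) \<Rightarrow> bool" where
  "indep_of_process T M Y W \<longleftrightarrow>
     prob_space.indep_set M
       (sets (vimage_algebra (space M) Y borel))
       (sets (vimage_algebra (space M) (\<lambda>x. \<lambda>t\<in>{0..T}. W t x) (Pi\<^sub>M {0..T} (\<lambda>_. borel))))"

(* X is a continuous process solving  dX = b(X) dt + sigma dW  on [0,T].  As the diffusion
   coefficient is constant and W 0 = 0 a.s., the stochastic integral of sigma from 0 to t is
   sigma * W t, so the integral form of the equation involves no Ito integral. *)
definition solves_additive_sde ::
    "real \<Rightarrow> 'w measure \<Rightarrow> (real \<Rightarrow> 'w \<Rightarrow> real) \<Rightarrow> (real \<Rightarrow> real) \<Rightarrow> real \<Rightarrow> (real \<Rightarrow> 'w \<Rightarrow> real) \<Rightarrow> bool" where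
  "solves_additive_sde T M W b \<sigma> X \<longleftrightarrow>
     (\<forall>t\<in>{0..T}. X t \<in> borel_measurable M) \<and>
     (\<forall>x\<in>space M. continuous_on {0..T} (\<lambda>t. X t x)) \<and>
     (AE x in M. \<forall>t\<in>{0..T}. X t x = X 0 x + (LBINT s:{0..t}. b (X s x)) + \<sigma> * W t x)"

definition increasing_enumeration :: "(nat \<Rightarrow> real) \<Rightarrow> real set \<Rightarrow> bool" where
  "increasing_enumeration \<omega> S \<longleftrightarrow> strict_mono_on {1..} \<omega> \<and> \<omega> ` {1..} = S"

definition L2_norm_on :: "real \<Rightarrow> (real \<Rightarrow> real) \<Rightarrow> real" where
  "L2_norm_on T f = sqrt (LBINT s:{0..T}. (f s)\<^sup>2)"

definition freqs_a :: "real \<Rightarrow> real \<Rightarrow> real set" where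
  "freqs_a \<theta> T = {\<omega>. \<omega> > 0 \<and> \<theta> * sin (\<omega> * T) + \<omega> * cos (\<omega> * T) = 0}"

definition eigfun_a :: "real \<Rightarrow> real \<Rightarrow> real \<Rightarrow> real" where
  "eigfun_a T \<omega> t = (T / 2 - sin (2 * \<omega> * T) / (4 * \<omega>)) powr (- 1 / 2) * sin (\<omega> * t)"

definition freqs_b :: "real \<Rightarrow> real \<Rightarrow> real \<Rightarrow> real \<Rightarrow> real set" where
  "freqs_b \<theta> \<sigma> \<sigma>0 T = {\<omega>. \<omega> > 0 \<and>
     \<omega> * \<sigma>\<^sup>2 * cos (\<omega> * T) + (\<theta> * \<sigma>\<^sup>2 - \<theta>\<^sup>2 * \<sigma>0\<^sup>2 - \<omega>\<^sup>2 * \<sigma>0\<^sup>2) * sin (\<omega> * T) = 0}"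

definition eigfun_b_raw :: "real \<Rightarrow> real \<Rightarrow> real \<Rightarrow> real \<Rightarrow> real \<Rightarrow> real" where
  "eigfun_b_raw \<theta> \<sigma> \<sigma>0 \<omega> t = \<omega> * \<sigma>0\<^sup>2 * cos (\<omega> * t) + (\<sigma>\<^sup>2 - \<theta> * \<sigma>0\<^sup>2) * sin (\<omega> * t)"

definition norm_const_b :: "real \<Rightarrow> real \<Rightarrow> real \<Rightarrow> real \<Rightarrow> real \<Rightarrow> real" where
  "norm_const_b \<theta> \<sigma> \<sigma>0 T \<omega> = 1 / L2_norm_on T (eigfun_b_raw \<theta> \<sigma> \<sigma>0 \<omega>)"

definition eigfun_b :: "real \<Rightarrow> real \<Rightarrow> real \<Rightarrow> real \<Rightarrow> real \<Rightarrow> real \<Rightarrow> real" where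
  "eigfun_b \<theta> \<sigma> \<sigma>0 T \<omega> t = norm_const_b \<theta> \<sigma> \<sigma>0 T \<omega> * eigfun_b_raw \<theta> \<sigma> \<sigma>0 \<omega> t"

definition freqs :: "real \<Rightarrow> real \<Rightarrow> real \<Rightarrow> real \<Rightarrow> real set" where
  "freqs \<theta> \<sigma> \<sigma>0 T = (if \<sigma>0 = 0 then freqs_a \<theta> T else freqs_b \<theta> \<sigma> \<sigma>0 T)"

definition eigfun :: "real \<Rightarrow> real \<Rightarrow> real \<Rightarrow> real \<Rightarrow> real \<Rightarrow> real \<Rightarrow> real" where
  "eigfun \<theta> \<sigma> \<sigma>0 T \<omega> = (if \<sigma>0 = 0 then eigfun_a T \<omega> else eigfun_b \<theta> \<sigma> \<sigma>0 T \<omega>)"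

(* The coefficients A and B attached to an interval [u,v] of the schedule (u = t_j, v = t_(j+1)). *)
definition coeff_A :: "real \<Rightarrow> real \<Rightarrow> (real \<Rightarrow> real) \<Rightarrow> real \<Rightarrow> real \<Rightarrow> real" where
  "coeff_A \<theta> \<omega> e u v = (let h = v - u in
     - \<theta> / (\<theta>\<^sup>2 + \<omega>\<^sup>2) *
       (2 * e v / (exp (\<theta> * h) - exp (- \<theta> * h))
        - e u * ((exp (\<theta> * h) + exp (- \<theta> * h)) / (exp (\<theta> * h) - exp (- \<theta> * h))))
     + 1 / (\<theta>\<^sup>2 + \<omega>\<^sup>2) * deriv e u)"

definition coeff_B :: "real \<Rightarrow> real \<Rightarrow> (real \<Rightarrow> real) \<Rightarrow> real \<Rightarrow> real \<Rightarrow> real" where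
  "coeff_B \<theta> \<omega> e u v = (let h = v - u in
     \<theta> / (\<theta>\<^sup>2 + \<omega>\<^sup>2) *
       (e v * ((exp (\<theta> * h) + exp (- \<theta> * h)) / (exp (\<theta> * h) - exp (- \<theta> * h)))
        - 2 * e u / (exp (\<theta> * h) - exp (- \<theta> * h)))
     - 1 / (\<theta>\<^sup>2 + \<omega>\<^sup>2) * deriv e v)"

definition assemble_coeff ::
    "(real \<Rightarrow> real \<Rightarrow> real) \<Rightarrow> (real \<Rightarrow> real \<Rightarrow> real) \<Rightarrow> nat \<Rightarrow> (nat \<Rightarrow> real) \<Rightarrow> nat \<Rightarrow> real" where
  "assemble_coeff A B n t j =
     (if j = 0 then A (t 0) (t 1)
      else if j = n then B (t (n - 1)) (t n)
      else A (t j) (t (j + 1)) + B (t (j - 1)) (t j))"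

definition regression_coeff ::
    "real \<Rightarrow> real \<Rightarrow> (real \<Rightarrow> real) \<Rightarrow> nat \<Rightarrow> (nat \<Rightarrow> real) \<Rightarrow> nat \<Rightarrow> real" where
  "regression_coeff \<theta> \<omega> e = assemble_coeff (coeff_A \<theta> \<omega> e) (coeff_B \<theta> \<omega> e)"

(* The same coefficients for a schedule whose dates may coincide: on an interval of length 0,
   A and B take their limit value 0.  (With x / 0 = 0, coeff_A and coeff_B themselves would
   give a wrong value there.) *)
definition regression_coeff_ext ::
    "real \<Rightarrow> real \<Rightarrow> (real \<Rightarrow> real) \<Rightarrow> nat \<Rightarrow> (nat \<Rightarrow> real) \<Rightarrow> nat \<Rightarrow> real" where
  "regression_coeff_ext \<theta> \<omega> e =
     assemble_coeff (\<lambda>u v. if u = v then 0 else coeff_A \<theta> \<omega> e u v)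
                    (\<lambda>u v. if u = v then 0 else coeff_B \<theta> \<omega> e u v)"

definition sigma_of_dates :: "'w measure \<Rightarrow> (real \<Rightarrow> 'w \<Rightarrow> real) \<Rightarrow> nat \<Rightarrow> (nat \<Rightarrow> real) \<Rightarrow> 'w measure" where
  "sigma_of_dates M X n t =
     vimage_algebra (space M) (\<lambda>x. \<lambda>j\<in>{0..n}. X (t j) x) (Pi\<^sub>M {0..n} (\<lambda>_. borel))"

end

theory Submission
  imports Defs
begin

text \<open>
  The rescaled process \<open>Y t = e\<^bsup>\<theta>t\<^esup> X t\<close> has independent centred Gaussian increments, which are also
  independent of the initial value, and the variance of an increment is an increment of
  \<open>\<sigma>\<^sup>2 e\<^bsup>2\<theta>t\<^esup> / (2\<theta>)\<close>. This comes from the equation itself: along refining partitions the increments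
  of \<open>Y\<close> are almost sure limits of weighted sums of Brownian increments
  (\<open>ou_path_increment_limit\<close>), and independence and normality pass to such limits
  (\<open>indep_vars_AE_limit\<close>, \<open>Y_increment_distr\<close>, \<open>initial_and_Y_increments_indep\<close>).

  Between two consecutive dates \<open>u < v\<close> the process is then a Gaussian bridge: for a time \<open>s\<close> in
  between, the difference of \<open>X s\<close> and its interpolation
  \<open>(sinh (\<theta>(v - s)) X u + sinh (\<theta>(s - u)) X v) / sinh (\<theta>(v - u))\<close> is a multiple of \<open>b\<^sup>2 U - a\<^sup>2 V\<close>, where \<open>U\<close>
  and \<open>V\<close> are the increments of \<open>Y\<close> over \<open>[u, s]\<close> and \<open>[s, v]\<close> and \<open>a\<^sup>2\<close>, \<open>b\<^sup>2\<close> are their variances up to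
  the common factor \<open>\<sigma>\<^sup>2\<close>. This form integrates to zero over every event depending on \<open>U + V\<close>
  (\<open>normal_bridge\<close>), and the observations see \<open>U\<close> and \<open>V\<close> only through \<open>U + V\<close>, the rest of them
  being independent of the pair. Hence the residual is orthogonal to every event of the observed
  sigma-algebra (\<open>bridge_residual_orthogonal\<close>).

  Integrating this over \<open>s\<close> against \<open>e\<close>, by Fubini's theorem, leaves the integrals of the two sinh weights
  against \<open>e\<close>. Since \<open>e'' = - \<omega>\<^sup>2 e\<close>, they can be evaluated in closed form and equal the coefficients
  \<open>A\<close> and \<open>B\<close> (\<open>sinh_weight_integral\<close>). Intervals of length zero contribute nothing, which
  gives the formula for schedules with coinciding dates at no extra cost
  (\<open>conditional_expectation_path_integral\<close>).
\<close>

section \<open>Independence: almost sure limits, adjoined variables, generated sigma-algebras\<close>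

text \<open>Together with dominated convergence this reduces independence to a
  factorization of expectations of continuous functions, which survives almost sure limits.\<close>

lemma closed_indicator_approx:
  fixes C :: "real set"
  assumes "closed C"
  obtains f :: "nat \<Rightarrow> real \<Rightarrow> real" where
    "\<And>q. continuous_on UNIV (f q)" "\<And>q x. 0 \<le> f q x" "\<And>q x. f q x \<le> 1"
    "\<And>x. (\<lambda>q. f q x) \<longlonglongrightarrow> indicator C x"
proof (cases "C = {}")
  case True
  show ?thesis
    by (rule that[of "\<lambda>_ _. 0"]) (auto simp: True)
next
  case False
  define f where "f = (\<lambda>(q::nat) x. max 0 (1 - real q * infdist x C))"
  show ?thesis
  proof (rule that[of f])
    show "continuous_on UNIV (f q)" for q
      unfolding f_def by (intro continuous_intros)
    show "0 \<le> f q x" "f q x \<le> 1" for q x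
      by (auto simp: f_def infdist_nonneg)
    fix x show "(\<lambda>q. f q x) \<longlonglongrightarrow> indicator C x"
    proof (cases "x \<in> C")
      case True
      then show ?thesis by (simp add: f_def)
    next
      case notin: False
      have pos: "infdist x C > 0"
        using notin assms False in_closed_iff_infdist_zero[of C x] infdist_nonneg[of x C]
        by linarith
      have "\<forall>\<^sub>F q in sequentially. f q x = 0"
      proof (rule eventually_sequentiallyI)
        fix q assume q: "nat \<lceil>1 / infdist x C\<rceil> \<le> q"
        then have "1 / infdist x C \<le> real q" by linarith
        then have "1 \<le> real q * infdist x C" using pos by (simp add: field_simps)
        then show "f q x = 0" by (simp add: f_def)
      qed
      then show ?thesis using notin by (simp add: tendsto_eventually)
    qed
  qed
qed

lemma (in prob_space) expectation_prod_indep: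
  fixes X :: "'i \<Rightarrow> 'a \<Rightarrow> real"
  assumes "finite I" "indep_vars (\<lambda>_. borel) X I"
    and f: "\<And>i. i \<in> I \<Longrightarrow> f i \<in> borel_measurable borel" "\<And>i x. 0 \<le> f i x" "\<And>i x. f i x \<le> (1::real)"
  shows "expectation (\<lambda>x. \<Prod>i\<in>I. f i (X i x)) = (\<Prod>i\<in>I. expectation (\<lambda>x. f i (X i x)))"
proof (rule indep_vars_lebesgue_integral)
  show ind: "indep_vars (\<lambda>_. borel) (\<lambda>i x. f i (X i x)) I"
    using indep_vars_compose2[OF assms(2), of f "\<lambda>_. borel"] f(1) by simp
  fix i assume "i \<in> I"
  then have "random_variable borel (\<lambda>x. f i (X i x))"
    using ind unfolding indep_vars_def by auto
  then show "integrable M (\<lambda>x. f i (X i x))"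
    using f by (intro integrable_const_bound[where B=1]) auto
qed fact

text \<open>Bounded continuous functions turn an almost sure limit into a limit of expectations, so the
  product formula passes from the approximating families to the limit. Indicators of closed
  sets are limits of such functions, and closed sets form an intersection-stable generator.\<close>

lemma (in prob_space) indep_vars_AE_limit:
  fixes X :: "'i \<Rightarrow> 'a \<Rightarrow> real" and Xm :: "nat \<Rightarrow> 'i \<Rightarrow> 'a \<Rightarrow> real"
  assumes fin: "finite I" "I \<noteq> {}"
    and ind: "\<And>m. indep_vars (\<lambda>_. borel) (Xm m) I"
    and rv: "\<And>i. i \<in> I \<Longrightarrow> random_variable borel (X i)"
    and lim: "\<And>i. i \<in> I \<Longrightarrow> AE x in M. (\<lambda>m. Xm m i x) \<longlonglongrightarrow> X i x"
  shows "indep_vars (\<lambda>_. borel) X I"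
proof -
  have rvm: "\<And>m i. i \<in> I \<Longrightarrow> random_variable borel (Xm m i)"
    using ind unfolding indep_vars_def by auto
  have cont: "expectation (\<lambda>x. \<Prod>i\<in>I. f i (X i x)) = (\<Prod>i\<in>I. expectation (\<lambda>x. f i (X i x)))"
    if f: "\<And>i. continuous_on UNIV (f i)" "\<And>i x. 0 \<le> f i x" "\<And>i x. f i x \<le> (1::real)"
    for f :: "'i \<Rightarrow> real \<Rightarrow> real"
  proof -
    have fm: "f i \<in> borel_measurable borel" for i
      by (intro borel_measurable_continuous_onI f)
    have mm: "random_variable borel (\<lambda>x. f i (Xm m i x))" "random_variable borel (\<lambda>x. f i (X i x))"
      if "i \<in> I" for i m
      using measurable_compose[OF rvm[OF that] fm] measurable_compose[OF rv[OF that] fm] by auto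
    have tend: "AE x in M. (\<lambda>m. f i (Xm m i x)) \<longlonglongrightarrow> f i (X i x)" if "i \<in> I" for i
      using lim[OF that]
    proof eventually_elim
      case (elim x)
      have "isCont (f i) (X i x)"
        using f(1)[of i] by (simp add: continuous_on_eq_continuous_at)
      from isCont_tendsto_compose[OF this elim] show ?case .
    qed
    have "(\<lambda>m. \<Prod>i\<in>I. expectation (\<lambda>x. f i (Xm m i x))) \<longlonglongrightarrow> (\<Prod>i\<in>I. expectation (\<lambda>x. f i (X i x)))"
    proof (rule tendsto_prod)
      fix i assume i: "i \<in> I"
      show "(\<lambda>m. expectation (\<lambda>x. f i (Xm m i x))) \<longlonglongrightarrow> expectation (\<lambda>x. f i (X i x))"
        by (rule integral_dominated_convergence[where w="\<lambda>_. 1"]) (use f mm[OF i] tend[OF i] in auto)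
    qed
    moreover have "(\<lambda>m. expectation (\<lambda>x. \<Prod>i\<in>I. f i (Xm m i x))) \<longlonglongrightarrow> expectation (\<lambda>x. \<Prod>i\<in>I. f i (X i x))"
    proof (rule integral_dominated_convergence[where w="\<lambda>_. 1"])
      have "AE x in M. \<forall>i\<in>I. (\<lambda>m. f i (Xm m i x)) \<longlonglongrightarrow> f i (X i x)"
        using fin tend by (subst AE_finite_all) auto
      then show "AE x in M. (\<lambda>m. \<Prod>i\<in>I. f i (Xm m i x)) \<longlonglongrightarrow> (\<Prod>i\<in>I. f i (X i x))"
        by eventually_elim (auto intro!: tendsto_prod)
      show "AE x in M. norm (\<Prod>i\<in>I. f i (Xm m i x)) \<le> 1" for m
        using f by (auto simp: abs_prod intro!: prod_le_1)
    qed (use mm in \<open>auto intro!: borel_measurable_prod\<close>)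
    moreover have "expectation (\<lambda>x. \<Prod>i\<in>I. f i (Xm m i x)) = (\<Prod>i\<in>I. expectation (\<lambda>x. f i (Xm m i x)))" for m
      by (rule expectation_prod_indep[OF fin(1) ind]) (use f fm in auto)
    ultimately show ?thesis
      using LIMSEQ_unique by auto
  qed
  show ?thesis
  proof (subst indep_vars_finite[where E="\<lambda>_. Collect closed"])
    show "sets (borel::real measure) = sigma_sets (space borel) (Collect closed)"
      by (simp add: borel_eq_closed)
    show "\<forall>A\<in>I \<rightarrow> Collect closed. prob (\<Inter>j\<in>I. X j -` A j \<inter> space M) = (\<Prod>j\<in>I. prob (X j -` A j \<inter> space M))"
    proof
      fix A assume A: "A \<in> I \<rightarrow> Collect (closed :: real set \<Rightarrow> bool)"
      have "\<exists>f :: nat \<Rightarrow> real \<Rightarrow> real. (\<forall>q. continuous_on UNIV (f q)) \<and> (\<forall>q x. 0 \<le> f q x) \<and> (\<forall>q x. f q x \<le> 1) \<and>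
          (i \<in> I \<longrightarrow> (\<forall>x. (\<lambda>q. f q x) \<longlonglongrightarrow> indicator (A i) x))" for i
      proof (cases "i \<in> I")
        case True
        then have "closed (A i)" using A by auto
        from closed_indicator_approx[OF this] show ?thesis by metis
      next
        case False
        then show ?thesis by (intro exI[of _ "\<lambda>_ _. 0"]) auto
      qed
      then obtain f :: "'i \<Rightarrow> nat \<Rightarrow> real \<Rightarrow> real" where
        f: "\<And>i q. continuous_on UNIV (f i q)" "\<And>i q x. 0 \<le> f i q x" "\<And>i q x. f i q x \<le> 1"
        and ft: "\<And>i x. i \<in> I \<Longrightarrow> (\<lambda>q. f i q x) \<longlonglongrightarrow> indicator (A i) x"
        by metis
      have fm: "f i q \<in> borel_measurable borel" for i q
        by (intro borel_measurable_continuous_onI f)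
      have mm: "random_variable borel (\<lambda>x. f i q (X i x))" if "i \<in> I" for i q
        using measurable_compose[OF rv[OF that] fm] by auto
      have ev: "X i -` A i \<inter> space M \<in> events" if "i \<in> I" for i
        using A that by (intro measurable_sets[OF rv[OF that]] borel_closed) auto
      have lim_prod: "(\<lambda>q. \<Prod>i\<in>I. expectation (\<lambda>x. f i q (X i x))) \<longlonglongrightarrow> (\<Prod>i\<in>I. expectation (indicator (X i -` A i \<inter> space M)))"
      proof (rule tendsto_prod)
        fix i assume i: "i \<in> I"
        show "(\<lambda>q. expectation (\<lambda>x. f i q (X i x))) \<longlonglongrightarrow> expectation (indicator (X i -` A i \<inter> space M))"
        proof (rule integral_dominated_convergence[where w="\<lambda>_. 1"])
          show "AE x in M. (\<lambda>q. f i q (X i x)) \<longlonglongrightarrow> indicator (X i -` A i \<inter> space M) x"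
          proof (rule AE_I2)
            fix x assume "x \<in> space M"
            then have "indicator (X i -` A i \<inter> space M) x = (indicator (A i) (X i x) :: real)"
              by (auto simp: indicator_def)
            then show "(\<lambda>q. f i q (X i x)) \<longlonglongrightarrow> indicator (X i -` A i \<inter> space M) x"
              using ft[OF i] by simp
          qed
        qed (use f mm[OF i] ev[OF i] in auto)
      qed
      have lim_joint: "(\<lambda>q. expectation (\<lambda>x. \<Prod>i\<in>I. f i q (X i x))) \<longlonglongrightarrow> expectation (indicator (\<Inter>i\<in>I. X i -` A i \<inter> space M))"
      proof (rule integral_dominated_convergence[where w="\<lambda>_. 1"])
        show "AE x in M. (\<lambda>q. \<Prod>i\<in>I. f i q (X i x)) \<longlonglongrightarrow> indicator (\<Inter>i\<in>I. X i -` A i \<inter> space M) x"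
        proof (rule AE_I2)
          fix x assume x: "x \<in> space M"
          have "(\<lambda>q. \<Prod>i\<in>I. f i q (X i x)) \<longlonglongrightarrow> (\<Prod>i\<in>I. indicator (A i) (X i x))"
            using ft by (intro tendsto_prod)
          also have "(\<Prod>i\<in>I. indicator (A i) (X i x)) = (indicator (\<Inter>i\<in>I. X i -` A i \<inter> space M) x :: real)"
            using fin x by (auto simp: indicator_def)
          finally show "(\<lambda>q. \<Prod>i\<in>I. f i q (X i x)) \<longlonglongrightarrow> indicator (\<Inter>i\<in>I. X i -` A i \<inter> space M) x" .
        qed
        show "AE x in M. norm (\<Prod>i\<in>I. f i q (X i x)) \<le> 1" for q
          using f by (auto simp: abs_prod intro!: prod_le_1)
        show "random_variable borel (indicat_real (\<Inter>i\<in>I. X i -` A i \<inter> space M))"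
          using fin ev by (intro borel_measurable_indicator sets.finite_INT) auto
      qed (use mm in \<open>auto intro!: borel_measurable_prod\<close>)
      have fac: "expectation (\<lambda>x. \<Prod>i\<in>I. f i q (X i x)) = (\<Prod>i\<in>I. expectation (\<lambda>x. f i q (X i x)))" for q
        using cont[of "\<lambda>i. f i q"] f by auto
      have "expectation (indicat_real (\<Inter>i\<in>I. X i -` A i \<inter> space M)) = (\<Prod>i\<in>I. expectation (indicat_real (X i -` A i \<inter> space M)))"
        by (rule LIMSEQ_unique[OF lim_joint[unfolded fac] lim_prod])
      moreover have "(\<Inter>i\<in>I. X i -` A i \<inter> space M) \<in> events"
        using fin ev by (intro sets.finite_INT) auto
      ultimately show "prob (\<Inter>j\<in>I. X j -` A j \<inter> space M) = (\<Prod>j\<in>I. prob (X j -` A j \<inter> space M))"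
        using ev by (simp add: Int_absorb2 del: INT_simps)
    qed
  qed (use fin rv in \<open>auto simp: Int_stable_def\<close>)
qed

text \<open>Independence from a whole sigma-algebra is what allows one more variable to be adjoined to a
  family of variables measurable with respect to that sigma-algebra.\<close>

lemma (in prob_space) indep_vars_case_nat:
  fixes S :: "nat \<Rightarrow> 'a \<Rightarrow> real"
  assumes S: "indep_vars (\<lambda>_. borel) S {..<N}"
    and X0: "random_variable borel X0"
    and F: "subalgebra M F" "\<And>k. k < N \<Longrightarrow> S k \<in> borel_measurable F"
    and ind: "indep_set (sets (vimage_algebra (space M) X0 borel)) (sets F)"
  shows "indep_vars (\<lambda>_. borel) (case_nat X0 S) {..N}"
proof (subst indep_vars_finite[where E="\<lambda>_. sets borel"])
  show "\<And>i. i \<in> {..N} \<Longrightarrow> random_variable borel (case i of 0 \<Rightarrow> X0 | Suc x \<Rightarrow> S x)"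
    using X0 S by (auto simp: indep_vars_def split: nat.split)
  show "\<forall>A\<in>{..N} \<rightarrow> sets borel. prob (\<Inter>j\<in>{..N}. (case j of 0 \<Rightarrow> X0 | Suc x \<Rightarrow> S x) -` A j \<inter> space M) =
       (\<Prod>j\<in>{..N}. prob ((case j of 0 \<Rightarrow> X0 | Suc x \<Rightarrow> S x) -` A j \<inter> space M))"
  proof
    fix A assume A: "A \<in> {..N} \<rightarrow> sets (borel::real measure)"
    define B where "B = (\<Inter>k\<in>{..<N}. S k -` A (Suc k) \<inter> space M) \<inter> space M"
    have spF: "space F = space M" using F(1) by (simp add: subalgebra_def)
    have B: "B \<in> sets F"
    proof (cases "N = 0")
      case True
      then show ?thesis unfolding B_def using spF sets.top[of F] by simp
    next
      case False
      then have "B = (\<Inter>k\<in>{..<N}. S k -` A (Suc k) \<inter> space F)" by (auto simp: B_def spF)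
      also have "\<dots> \<in> sets F"
        using F(2) A False by (intro sets.finite_INT measurable_sets[of _ F borel]) auto
      finally show ?thesis .
    qed
    have X0A: "X0 -` A 0 \<inter> space M \<in> sets (vimage_algebra (space M) X0 borel)"
      using A by (intro in_vimage_algebra) auto
    have "(\<Inter>j\<in>{..N}. (case j of 0 \<Rightarrow> X0 | Suc x \<Rightarrow> S x) -` A j \<inter> space M) = (X0 -` A 0 \<inter> space M) \<inter> B"
      unfolding B_def atMost_Suc_eq_insert_0 lessThan_Suc_atMost[symmetric]
      by (auto simp: lessThan_Suc_eq_insert_0)
    then have "prob (\<Inter>j\<in>{..N}. (case j of 0 \<Rightarrow> X0 | Suc x \<Rightarrow> S x) -` A j \<inter> space M) = prob (X0 -` A 0 \<inter> space M) * prob B"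
      using indep_setD[OF ind X0A B] by simp
    also have "prob B = (\<Prod>k<N. prob (S k -` A (Suc k) \<inter> space M))"
    proof (cases "N = 0")
      case True then show ?thesis by (simp add: B_def prob_space)
    next
      case False
      then have "B = (\<Inter>k\<in>{..<N}. S k -` A (Suc k) \<inter> space M)" by (auto simp: B_def)
      also have "prob \<dots> = (\<Prod>k<N. prob (S k -` A (Suc k) \<inter> space M))"
        using S A False by (intro indep_varsD_finite[OF S]) auto
      finally show ?thesis .
    qed
    also have "prob (X0 -` A 0 \<inter> space M) * (\<Prod>k<N. prob (S k -` A (Suc k) \<inter> space M)) =
        (\<Prod>j\<in>{..N}. prob ((case j of 0 \<Rightarrow> X0 | Suc x \<Rightarrow> S x) -` A j \<inter> space M))"
      by (simp add: lessThan_Suc_atMost[symmetric] prod.lessThan_Suc_shift del: prod.lessThan_Suc)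
    finally show "prob (\<Inter>j\<in>{..N}. (case j of 0 \<Rightarrow> X0 | Suc x \<Rightarrow> S x) -` A j \<inter> space M) =
       (\<Prod>j\<in>{..N}. prob ((case j of 0 \<Rightarrow> X0 | Suc x \<Rightarrow> S x) -` A j \<inter> space M))" .
  qed
qed (auto simp: sets.sigma_sets_eq[of borel, simplified] Int_stable_def)

text \<open>Integrating against the product law and freezing the value of \<open>Y\<close> leaves, for every section
  of \<open>A\<close>, an expectation that involves \<open>Q\<close> alone. So an orthogonality that only concerns \<open>Q\<close>
  extends to the sigma-algebra generated by \<open>(Y, h Q)\<close>.\<close>

lemma (in prob_space) indep_var_zero_on_generated:
  fixes g :: "'c \<Rightarrow> real"
  assumes ind: "indep_var S Y P Q"
    and g: "g \<in> borel_measurable P" and h: "h \<in> measurable P P'"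
    and int: "integrable M (\<lambda>x. g (Q x))"
    and zero: "\<And>B. B \<in> sets P' \<Longrightarrow> expectation (\<lambda>x. g (Q x) * indicator B (h (Q x))) = 0"
    and A: "A \<in> sets (S \<Otimes>\<^sub>M P')"
  shows "expectation (\<lambda>x. g (Q x) * indicator A (Y x, h (Q x))) = 0"
proof -
  note g[measurable] h[measurable] A[measurable]
  have Y[measurable]: "random_variable S Y" and Q[measurable]: "random_variable P Q"
    using ind by (auto dest: indep_var_rv1 indep_var_rv2)
  have eq: "distr M S Y \<Otimes>\<^sub>M distr M P Q = distr M (S \<Otimes>\<^sub>M P) (\<lambda>x. (Y x, Q x))"
    using ind by (simp add: indep_var_distribution_eq)
  interpret DY: prob_space "distr M S Y" by (rule prob_space_distr) fact
  interpret DQ: prob_space "distr M P Q" by (rule prob_space_distr) fact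
  interpret D: pair_prob_space "distr M S Y" "distr M P Q" ..
  let ?f = "\<lambda>(y, q). g q * indicator A (y, h q)"
  have f[measurable]: "?f \<in> borel_measurable (S \<Otimes>\<^sub>M P)" by measurable
  have int': "integrable (distr M S Y \<Otimes>\<^sub>M distr M P Q) ?f"
  proof -
    have "integrable M (\<lambda>x. g (Q x) * indicator A (Y x, h (Q x)))"
      by (rule Bochner_Integration.integrable_bound[OF int]) (auto simp: indicator_def)
    then show ?thesis unfolding eq by (subst integrable_distr_eq) auto
  qed
  have "expectation (\<lambda>x. g (Q x) * indicator A (Y x, h (Q x))) = integral\<^sup>L (distr M (S \<Otimes>\<^sub>M P) (\<lambda>x. (Y x, Q x))) ?f"
    by (subst integral_distr) auto
  also have "\<dots> = (\<integral>y. (\<integral>q. ?f (y, q) \<partial>distr M P Q) \<partial>distr M S Y)"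
    unfolding eq[symmetric] by (rule D.integral_fst'[symmetric, OF int'])
  also have "\<dots> = (\<integral>y. 0 \<partial>distr M S Y)"
  proof (rule Bochner_Integration.integral_cong[OF refl])
    fix y assume "y \<in> space (distr M S Y)"
    then have y: "y \<in> space S" by simp
    have B: "Pair y -` A \<in> sets P'"
      by (rule sets_Pair1[OF A])
    have "(\<integral>q. ?f (y, q) \<partial>distr M P Q) = (\<integral>x. g (Q x) * indicator (Pair y -` A) (h (Q x)) \<partial>M)"
      using y B by (subst integral_distr) (auto simp: indicator_def)
    then show "(\<integral>q. ?f (y, q) \<partial>distr M P Q) = 0" using zero[OF B] by simp
  qed
  finally show ?thesis by simp
qed

section \<open>Centred normal laws and the Gaussian bridge\<close>

lemma centred_normal_real_distribution: "s \<ge> 0 \<Longrightarrow> real_distribution (centred_normal s)"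
  unfolding real_distribution_def real_distribution_axioms_def centred_normal_def
  by (auto intro!: prob_space_return prob_space_normal_density)

text \<open>The formula includes the Dirac mass \<open>s = 0\<close>; it therefore identifies limit laws without
  separating degenerate from nondegenerate variances.\<close>

lemma char_centred_normal:
  assumes "s \<ge> 0"
  shows "char (centred_normal s) \<xi> = complex_of_real (exp (- (s\<^sup>2 * \<xi>\<^sup>2) / 2))"
proof (cases "s = 0")
  case True
  then show ?thesis by (simp add: centred_normal_def char_def integral_return)
next
  case False
  then have s: "s > 0" using assms by simp
  interpret S: prob_space std_normal_distribution
    by (intro prob_space_normal_density) simp
  have "distributed std_normal_distribution lborel (\<lambda>x. x) (\<lambda>x. ennreal (std_normal_density x))"
    unfolding distributed_def by (simp add: distr_id2)
  from S.normal_density_affine[OF this, of s 0] s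
  have "distributed std_normal_distribution lborel (\<lambda>x. s * x) (\<lambda>x. ennreal (normal_density 0 s x))"
    by simp
  then have "distr std_normal_distribution lborel (\<lambda>x. s * x) = density lborel (normal_density 0 s)"
    by (simp add: distributed_def)
  then have "centred_normal s = distr std_normal_distribution lborel (\<lambda>x. s * x)"
    using s by (simp add: centred_normal_def)
  also have "char \<dots> \<xi> = char std_normal_distribution (s * \<xi>)"
    unfolding char_def by (subst integral_distr) (auto simp: mult_ac)
  finally show ?thesis
    by (simp add: char_std_normal_distribution power_mult_distrib)
qed

lemma (in prob_space) distributed_centred_normal:
  assumes [measurable]: "random_variable borel X" and "distr M borel X = centred_normal s" "s > 0"
  shows "distributed M lborel X (\<lambda>x. ennreal (normal_density 0 s x))"
proof -
  have "distr M lborel X = distr M borel X" by (rule distr_cong) auto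
  then show ?thesis using assms by (simp add: distributed_def centred_normal_def)
qed

lemma (in prob_space) centred_normal_0_AE:
  assumes [measurable]: "random_variable borel X" and "distr M borel X = centred_normal 0"
  shows "AE x in M. X x = (0::real)"
proof -
  have "AE y in distr M borel X. y = 0"
    unfolding assms(2) centred_normal_def by (simp add: AE_return)
  then show ?thesis by (simp add: AE_distr_iff)
qed

lemma (in prob_space) centred_normal_square_moment:
  assumes X[measurable]: "random_variable borel X" and d: "distr M borel X = centred_normal s" and s: "s \<ge> 0"
  shows "integrable M (\<lambda>x. (X x)\<^sup>2)" "expectation (\<lambda>x. (X x)\<^sup>2) = s\<^sup>2"
proof -
  have "integrable M (\<lambda>x. (X x)\<^sup>2) \<and> expectation (\<lambda>x. (X x)\<^sup>2) = s\<^sup>2"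
  proof (cases "s = 0")
    case True
    with centred_normal_0_AE X d have AE: "AE x in M. (X x)\<^sup>2 = 0" by auto
    have "integrable M (\<lambda>x. (X x)\<^sup>2) \<longleftrightarrow> integrable M (\<lambda>x. 0::real)"
      by (rule integrable_cong_AE) (use AE in auto)
    moreover have "expectation (\<lambda>x. (X x)\<^sup>2) = expectation (\<lambda>x. 0::real)"
      by (rule integral_cong_AE) (use AE in auto)
    ultimately show ?thesis using True by simp
  next
    case False
    then have s: "s > 0" using s by simp
    note D = distributed_centred_normal[OF X d s]
    have "has_bochner_integral lborel (\<lambda>x. normal_density 0 s x * x\<^sup>2) (s\<^sup>2)"
      using normal_moment_even[OF s, of 0 1] by (simp add: eval_nat_numeral)
    then show ?thesis
      using distributed_integrable[OF D, of "\<lambda>x. x\<^sup>2"] distributed_integral[OF D, of "\<lambda>x. x\<^sup>2"]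
      by (auto simp: has_bochner_integral_iff)
  qed
  then show "integrable M (\<lambda>x. (X x)\<^sup>2)" "expectation (\<lambda>x. (X x)\<^sup>2) = s\<^sup>2" by auto
qed

lemma (in prob_space) centred_normal_abs_moment:
  assumes X[measurable]: "random_variable borel X" and d: "distr M borel X = centred_normal s" and s: "s \<ge> 0"
  shows "integrable M X" "expectation (\<lambda>x. \<bar>X x\<bar>) \<le> 1 + s\<^sup>2"
proof -
  note sq = centred_normal_square_moment[OF assms]
  have le: "\<bar>y\<bar> \<le> 1 + y\<^sup>2" for y :: real
  proof -
    have "0 \<le> (\<bar>y\<bar> - 1/2)\<^sup>2" by simp
    also have "\<dots> = \<bar>y\<bar>\<^sup>2 - \<bar>y\<bar> + 1/4" by (simp add: power2_eq_square field_simps)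
    finally show ?thesis unfolding power2_abs by linarith
  qed
  have i: "integrable M (\<lambda>x. 1 + (X x)\<^sup>2)" using sq by simp
  show int: "integrable M X"
    by (rule Bochner_Integration.integrable_bound[OF i]) (auto intro!: AE_I2 order.trans[OF le])
  have "expectation (\<lambda>x. \<bar>X x\<bar>) \<le> expectation (\<lambda>x. 1 + (X x)\<^sup>2)"
    using int i le by (intro integral_mono) auto
  also have "\<dots> = 1 + s\<^sup>2" using sq by (simp add: prob_space)
  finally show "expectation (\<lambda>x. \<bar>X x\<bar>) \<le> 1 + s\<^sup>2" .
qed

text \<open>Completion of the square. With \<open>w\<close> the value of the sum of two independent centred normal
  variables, the second factor is the conditional density of the first of them given \<open>w\<close>.\<close>

lemma normal_density_regression:
  fixes \<alpha> \<beta> u w :: real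
  assumes "\<alpha> > 0" "\<beta> > 0"
  shows "normal_density 0 \<alpha> u * normal_density 0 \<beta> (w - u) =
    normal_density 0 (sqrt (\<alpha>\<^sup>2 + \<beta>\<^sup>2)) w *
    normal_density (\<alpha>\<^sup>2 * w / (\<alpha>\<^sup>2 + \<beta>\<^sup>2)) (\<alpha> * \<beta> / sqrt (\<alpha>\<^sup>2 + \<beta>\<^sup>2)) u"
proof -
  define a b where "a = \<alpha>\<^sup>2" and "b = \<beta>\<^sup>2"
  have [simp, arith]: "a > 0" "b > 0" using assms by (auto simp: a_def b_def)
  have sq: "sqrt (2 * pi * (a + b)) * sqrt (2 * pi * (a * b) / (a + b)) = sqrt (2 * pi * a) * sqrt (2 * pi * b)"
    by (subst power_eq_iff_eq_base[symmetric, where n=2])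
       (simp_all add: real_sqrt_mult[symmetric] power2_eq_square)
  have e: "- (u\<^sup>2 / (2 * a)) - (w - u)\<^sup>2 / (2 * b) = - (w\<^sup>2 / (2 * (a + b))) - (u - a * w / (a + b))\<^sup>2 / (2 * (a * b / (a + b)))"
  proof -
    have "a + b \<noteq> 0" using \<open>a > 0\<close> \<open>b > 0\<close> by linarith
    then show ?thesis
      using \<open>a > 0\<close> \<open>b > 0\<close> by (simp add: divide_simps power2_eq_square) (simp add: algebra_simps)
  qed
  have tau: "(\<alpha> * \<beta> / sqrt (\<alpha>\<^sup>2 + \<beta>\<^sup>2))\<^sup>2 = a * b / (a + b)"
    by (simp add: power_divide power_mult_distrib a_def b_def)
  have "normal_density 0 \<alpha> u * normal_density 0 \<beta> (w - u) =
     1 / (sqrt (2 * pi * a) * sqrt (2 * pi * b)) * exp (- (u\<^sup>2 / (2 * a)) - (w - u)\<^sup>2 / (2 * b))"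
    by (simp add: normal_density_def a_def b_def mult_exp_exp)
  also have "\<dots> = 1 / (sqrt (2 * pi * (a + b)) * sqrt (2 * pi * (a * b) / (a + b))) *
     exp (- (w\<^sup>2 / (2 * (a + b))) - (u - a * w / (a + b))\<^sup>2 / (2 * (a * b / (a + b))))"
    unfolding sq e ..
  also have "\<dots> = normal_density 0 (sqrt (\<alpha>\<^sup>2 + \<beta>\<^sup>2)) w *
    normal_density (\<alpha>\<^sup>2 * w / (\<alpha>\<^sup>2 + \<beta>\<^sup>2)) (\<alpha> * \<beta> / sqrt (\<alpha>\<^sup>2 + \<beta>\<^sup>2)) u"
    unfolding normal_density_def tau
    by (simp add: a_def[symmetric] b_def[symmetric] mult_exp_exp)
  finally show ?thesis .
qed

text \<open>In the coordinates \<open>u\<close>, \<open>w = u + v\<close> the linear form is a multiple of \<open>u\<close> minus its conditional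
  mean given \<open>w\<close>, so integrating first over \<open>u\<close> gives \<open>0\<close> whatever the set \<open>B\<close>.\<close>

lemma (in prob_space) normal_bridge_pos:
  assumes ind: "indep_var borel U borel V" and pos: "\<alpha> > 0" "\<beta> > 0"
    and U: "distr M borel U = centred_normal \<alpha>" and V: "distr M borel V = centred_normal \<beta>"
    and B[measurable]: "B \<in> sets (borel :: real measure)"
  shows "expectation (\<lambda>x. (\<beta>\<^sup>2 * U x - \<alpha>\<^sup>2 * V x) * indicator B (U x + V x)) = 0"
proof -
  have rU[measurable]: "random_variable borel U" and rV[measurable]: "random_variable borel V"
    using ind by (auto dest: indep_var_rv1 indep_var_rv2)
  define g where "g = (\<lambda>(u, v). (\<beta>\<^sup>2 * u - \<alpha>\<^sup>2 * v) * indicator B (u + v) :: real)"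
  define p where "p = (\<lambda>(u, v). normal_density 0 \<alpha> u * normal_density 0 \<beta> v)"
  define G where "G = (\<lambda>z. p z * g z)"
  have gm[measurable]: "g \<in> borel_measurable (lborel \<Otimes>\<^sub>M lborel)" unfolding g_def by measurable
  have pm[measurable]: "p \<in> borel_measurable (lborel \<Otimes>\<^sub>M lborel)" unfolding p_def by measurable
  have Gm: "G \<in> borel_measurable (lborel \<Otimes>\<^sub>M lborel)" unfolding G_def by measurable
  have Gm'[measurable]: "(\<lambda>w. G (f w, h w)) \<in> borel_measurable N"
    if "f \<in> borel_measurable N" "h \<in> borel_measurable N" for f h and N :: "'z measure"
    by (rule measurable_compose[OF _ Gm]) (use that in measurable)
  have ind': "indep_var lborel U lborel V"
    using ind by (simp add: indep_var_def indep_vars_def sets_lborel space_lborel measurable_lborel2 bool.case_distrib cong: bool.case_cong)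
  have D: "distributed M (lborel \<Otimes>\<^sub>M lborel) (\<lambda>x. (U x, V x)) (\<lambda>z. ennreal (p z))"
  proof -
    have "distributed M (lborel \<Otimes>\<^sub>M lborel) (\<lambda>x. (U x, V x)) (\<lambda>(u, v). ennreal (normal_density 0 \<alpha> u) * ennreal (normal_density 0 \<beta> v))"
      by (rule distributed_joint_indep[OF _ _ distributed_centred_normal[OF rU U pos(1)] distributed_centred_normal[OF rV V pos(2)] ind'])
         (auto intro: sigma_finite_lborel)
    then show ?thesis by (simp add: p_def case_prod_beta' ennreal_mult')
  qed
  have p0: "p z \<ge> 0" for z by (auto simp: p_def split: prod.split)
  have iG: "integrable (lborel \<Otimes>\<^sub>M lborel) G"
  proof -
    have "integrable M (\<lambda>x. g (U x, V x))"
    proof (rule Bochner_Integration.integrable_bound)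
      show "integrable M (\<lambda>x. \<beta>\<^sup>2 * \<bar>U x\<bar> + \<alpha>\<^sup>2 * \<bar>V x\<bar>)"
        using centred_normal_abs_moment(1)[OF rU U] centred_normal_abs_moment(1)[OF rV V] pos by auto
      show "AE x in M. norm (g (U x, V x)) \<le> norm (\<beta>\<^sup>2 * \<bar>U x\<bar> + \<alpha>\<^sup>2 * \<bar>V x\<bar>)"
      proof (rule AE_I2)
        fix x
        have "\<bar>\<beta>\<^sup>2 * U x - \<alpha>\<^sup>2 * V x\<bar> \<le> \<bar>\<beta>\<^sup>2 * U x\<bar> + \<bar>\<alpha>\<^sup>2 * V x\<bar>" by (rule abs_triangle_ineq4)
        then show "norm (g (U x, V x)) \<le> norm (\<beta>\<^sup>2 * \<bar>U x\<bar> + \<alpha>\<^sup>2 * \<bar>V x\<bar>)"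
          by (auto simp: g_def indicator_def abs_mult)
      qed
      show "(\<lambda>x. g (U x, V x)) \<in> borel_measurable M" unfolding g_def by measurable
    qed
    then show ?thesis
      unfolding G_def using distributed_integrable[OF D gm] p0 by auto
  qed
  \<comment> \<open>passage to the coordinates \<open>(u, w)\<close> by translation of the inner integral\<close>
  have shift_int: "(\<integral>v. f v \<partial>lborel) = (\<integral>w. f (w - u) \<partial>lborel)" for f :: "real \<Rightarrow> real" and u
    using lborel_integral_real_affine[of 1 f "-u"] by (simp add: add.commute[of "-u"])
  have shift_ble: "integrable lborel f \<Longrightarrow> integrable lborel (\<lambda>w. f (w - u))" for f :: "real \<Rightarrow> real" and u
    using lborel_integrable_real_affine[of f 1 "-u"] by (simp add: add.commute[of "-u"])
  have iG2: "integrable (lborel \<Otimes>\<^sub>M lborel) (\<lambda>z. G (fst z, snd z - fst z))"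
  proof (rule lborel_pair.Fubini_integrable)
    have "integrable lborel (\<lambda>u. \<integral>v. norm (G (u, v)) \<partial>lborel)"
      using lborel_pair.integrable_fst'[OF integrable_norm[OF iG]] .
    also have "(\<lambda>u. \<integral>v. norm (G (u, v)) \<partial>lborel) = (\<lambda>u. \<integral>w. norm (G (u, w - u)) \<partial>lborel)"
      by (rule ext, rule shift_int)
    finally show "integrable lborel (\<lambda>u. \<integral>w. norm (G (fst (u, w), snd (u, w) - fst (u, w))) \<partial>lborel)" by simp
    show "AE u in lborel. integrable lborel (\<lambda>w. G (fst (u, w), snd (u, w) - fst (u, w)))"
      using lborel_pair.AE_integrable_fst'[OF iG] by eventually_elim (use shift_ble in simp)
  qed measurable
  have zero: "(\<integral>u. G (u, w - u) \<partial>lborel) = 0" for w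
  proof -
    let ?c = "\<alpha>\<^sup>2 + \<beta>\<^sup>2"
    let ?\<mu> = "\<alpha>\<^sup>2 * w / ?c" and ?\<tau> = "\<alpha> * \<beta> / sqrt ?c"
    have c: "?c > 0" using pos by (simp add: add_pos_pos)
    have \<tau>: "?\<tau> > 0" using pos c by simp
    have "G (u, w - u) = (normal_density 0 (sqrt ?c) w * indicator B w * ?c) * (normal_density ?\<mu> ?\<tau> u * (u - ?\<mu>))" for u
    proof -
      have "\<beta>\<^sup>2 * u - \<alpha>\<^sup>2 * (w - u) = ?c * (u - ?\<mu>)"
        using c by (simp add: right_diff_distrib) (simp add: algebra_simps)
      moreover have "p (u, w - u) = normal_density 0 (sqrt ?c) w * normal_density ?\<mu> ?\<tau> u"
        unfolding p_def using normal_density_regression[OF pos] by simp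
      ultimately show ?thesis unfolding G_def g_def by simp
    qed
    then have "(\<integral>u. G (u, w - u) \<partial>lborel) =
        (normal_density 0 (sqrt ?c) w * indicator B w * ?c) * (\<integral>u. normal_density ?\<mu> ?\<tau> u * (u - ?\<mu>) \<partial>lborel)"
      by simp
    also have "(\<integral>u. normal_density ?\<mu> ?\<tau> u * (u - ?\<mu>) \<partial>lborel) = 0"
      using integral_normal_moment_odd[OF \<tau>, of ?\<mu> 0] by simp
    finally show ?thesis by simp
  qed
  have "expectation (\<lambda>x. g (U x, V x)) = (\<integral>z. G z \<partial>(lborel \<Otimes>\<^sub>M lborel))"
    unfolding G_def using distributed_integral[OF D gm] p0 by auto
  also have "\<dots> = (\<integral>u. \<integral>v. G (u, v) \<partial>lborel \<partial>lborel)"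
    by (rule lborel_pair.integral_fst'[symmetric, OF iG])
  also have "\<dots> = (\<integral>u. \<integral>w. G (u, w - u) \<partial>lborel \<partial>lborel)"
    by (rule Bochner_Integration.integral_cong[OF refl], rule shift_int)
  also have "\<dots> = (\<integral>w. \<integral>u. G (u, w - u) \<partial>lborel \<partial>lborel)"
    using lborel_pair.Fubini_integral[of "\<lambda>u w. G (u, w - u)"] iG2 by (simp add: case_prod_beta')
  also have "\<dots> = 0" by (simp add: zero)
  finally show ?thesis by (simp add: g_def)
qed

text \<open>The common factor \<open>\<sigma>\<close> is kept outside of the linear form so that the statement remains
  usable for \<open>\<sigma> = 0\<close>, when the variables vanish although the form does not degenerate.\<close>

lemma (in prob_space) normal_bridge:
  assumes ind: "indep_var borel U borel V" and nn: "\<sigma> \<ge> 0" "a \<ge> 0" "b \<ge> 0"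
    and U: "distr M borel U = centred_normal (\<sigma> * a)" and V: "distr M borel V = centred_normal (\<sigma> * b)"
    and B[measurable]: "B \<in> sets (borel :: real measure)"
  shows "expectation (\<lambda>x. (b\<^sup>2 * U x - a\<^sup>2 * V x) * indicator B (U x + V x)) = 0"
proof (cases "\<sigma> * a > 0 \<and> \<sigma> * b > 0")
  case True
  have "expectation (\<lambda>x. (b\<^sup>2 * U x - a\<^sup>2 * V x) * indicator B (U x + V x)) =
    expectation (\<lambda>x. inverse (\<sigma>\<^sup>2) * (((\<sigma> * b)\<^sup>2 * U x - (\<sigma> * a)\<^sup>2 * V x) * indicator B (U x + V x)))"
    using True by (intro Bochner_Integration.integral_cong refl)
      (auto simp: power_mult_distrib right_diff_distrib[symmetric] mult.assoc zero_less_mult_iff)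
  also have "\<dots> = inverse (\<sigma>\<^sup>2) * expectation (\<lambda>x. ((\<sigma> * b)\<^sup>2 * U x - (\<sigma> * a)\<^sup>2 * V x) * indicator B (U x + V x))"
    by (rule integral_mult_right_zero)
  also have "\<dots> = 0"
    using normal_bridge_pos[OF ind _ _ U V B] True by simp
  finally show ?thesis .
next
  case False
  have [measurable]: "random_variable borel U" "random_variable borel V"
    using ind by (auto dest: indep_var_rv1 indep_var_rv2)
  have "\<sigma> = 0 \<or> a = 0 \<or> b = 0" using False nn by (auto simp: zero_less_mult_iff)
  then have "AE x in M. b\<^sup>2 * U x - a\<^sup>2 * V x = 0"
  proof (elim disjE)
    assume "\<sigma> = 0"
    then have "AE x in M. U x = 0" "AE x in M. V x = 0"
      using U V by (auto intro!: centred_normal_0_AE)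
    then show ?thesis by eventually_elim simp
  next
    assume "a = 0"
    then have "AE x in M. U x = 0" using U by (auto intro!: centred_normal_0_AE)
    then show ?thesis by eventually_elim (simp add: \<open>a = 0\<close>)
  next
    assume "b = 0"
    then have "AE x in M. V x = 0" using V by (auto intro!: centred_normal_0_AE)
    then show ?thesis by eventually_elim (simp add: \<open>b = 0\<close>)
  qed
  then have "expectation (\<lambda>x. (b\<^sup>2 * U x - a\<^sup>2 * V x) * indicator B (U x + V x)) = expectation (\<lambda>x. 0)"
    by (intro integral_cong_AE) auto
  then show ?thesis by simp
qed

section \<open>Riemann sums along equidistant partitions\<close>

definition part_pt :: "real \<Rightarrow> real \<Rightarrow> nat \<Rightarrow> nat \<Rightarrow> real" where
  "part_pt a b q l = a + (b - a) * (real l / real q)"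

lemma part_pt_0 [simp]: "part_pt a b q 0 = a"
  by (simp add: part_pt_def)

lemma part_pt_last [simp]: "q > 0 \<Longrightarrow> part_pt a b q q = b"
  by (simp add: part_pt_def)

lemma part_pt_diff: "part_pt a b q (Suc l) - part_pt a b q l = (b - a) / q"
  by (cases "q = 0") (simp_all add: part_pt_def field_simps)

lemma part_pt_mono: "a \<le> b \<Longrightarrow> part_pt a b q l \<le> part_pt a b q (Suc l)"
  using part_pt_diff[of a b q l] divide_nonneg_nonneg[of "b - a" "real q"] by linarith

lemma part_pt_bounds:
  assumes "a \<le> b" "l \<le> q" "q > 0"
  shows "a \<le> part_pt a b q l" "part_pt a b q l \<le> b"
proof -
  have "0 \<le> real l / q" "real l / q \<le> 1" using assms by auto
  then show "a \<le> part_pt a b q l" "part_pt a b q l \<le> b"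
    using assms mult_left_le[of "real l / q" "b - a"] by (auto simp: part_pt_def)
qed

lemma exp_increment_bounds:
  fixes c u v :: real
  assumes "c > 0" "u \<le> v"
  shows "c * exp (c * u) * (v - u) \<le> exp (c * v) - exp (c * u)"
    "exp (c * v) - exp (c * u) \<le> c * exp (c * v) * (v - u)"
proof -
  have "exp (c * u) * (1 + c * (v - u)) \<le> exp (c * u) * exp (c * (v - u))"
    by (intro mult_left_mono exp_ge_add_one_self) auto
  also have "\<dots> = exp (c * v)" by (simp add: exp_add[symmetric] algebra_simps)
  finally show "c * exp (c * u) * (v - u) \<le> exp (c * v) - exp (c * u)" by (simp add: algebra_simps)
  have "exp (c * v) * (1 + c * (u - v)) \<le> exp (c * v) * exp (c * (u - v))"
    by (intro mult_left_mono exp_ge_add_one_self) auto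
  also have "\<dots> = exp (c * u)" by (simp add: exp_add[symmetric] algebra_simps)
  finally show "exp (c * v) - exp (c * u) \<le> c * exp (c * v) * (v - u)" by (simp add: algebra_simps)
qed

lemma sum_exp_partition:
  "(\<Sum>l<Suc m. exp (c * part_pt a b (Suc m) (Suc l)) - exp (c * part_pt a b (Suc m) l)) = exp (c * b) - exp (c * a)"
  using sum_lessThan_telescope[of "\<lambda>l. exp (c * part_pt a b (Suc m) l)" "Suc m"] by simp

text \<open>On each subinterval the error lies between 0 and the mesh width times the increment of the
  exponential, so the total error telescopes to the mesh width times the increment over \<open>[a, b]\<close>.\<close>

lemma exp_riemann_sum:
  fixes c a b :: real
  assumes "c > 0" "a \<le> b"
  shows "(\<lambda>m. \<Sum>l<Suc m. exp (c * part_pt a b (Suc m) l) * (part_pt a b (Suc m) (Suc l) - part_pt a b (Suc m) l))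
    \<longlonglongrightarrow> (exp (c * b) - exp (c * a)) / c" (is "?S \<longlonglongrightarrow> ?I")
proof -
  have bnd: "\<bar>?I - ?S m\<bar> \<le> ((b - a) * (exp (c * b) - exp (c * a))) * inverse (real (Suc m))" for m
  proof -
    let ?z = "part_pt a b (Suc m)"
    let ?h = "(b - a) / Suc m"
    have I: "?I = (\<Sum>l<Suc m. (exp (c * ?z (Suc l)) - exp (c * ?z l)) / c)"
      unfolding sum_divide_distrib[symmetric] sum_exp_partition ..
    have S: "?S m = (\<Sum>l<Suc m. exp (c * ?z l) * ?h)"
      by (intro sum.cong refl) (simp add: part_pt_diff)
    have t: "0 \<le> (exp (c * ?z (Suc l)) - exp (c * ?z l)) / c - exp (c * ?z l) * ?h \<and>
       (exp (c * ?z (Suc l)) - exp (c * ?z l)) / c - exp (c * ?z l) * ?h \<le> ?h * (exp (c * ?z (Suc l)) - exp (c * ?z l))" for l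
    proof -
      note e = exp_increment_bounds[OF assms(1) part_pt_mono[OF assms(2), of "Suc m" l]]
      have "0 \<le> (V - U) / c - U * h \<and> (V - U) / c - U * h \<le> h * (V - U)"
        if "c * U * h \<le> V - U" "V - U \<le> c * V * h" for U V h :: real
      proof -
        have "(V - U) / c \<le> V * h" "U * h \<le> (V - U) / c"
          using that assms(1) by (simp_all add: pos_divide_le_eq pos_le_divide_eq mult_ac)
        then show ?thesis by (simp add: algebra_simps)
      qed
      from this[OF e[unfolded part_pt_diff]] show ?thesis .
    qed
    have "?I - ?S m = (\<Sum>l<Suc m. (exp (c * ?z (Suc l)) - exp (c * ?z l)) / c - exp (c * ?z l) * ?h)"
      unfolding I S sum_subtractf ..
    moreover have "0 \<le> \<dots>" using t by (intro sum_nonneg) blast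
    moreover have "(\<Sum>l<Suc m. (exp (c * ?z (Suc l)) - exp (c * ?z l)) / c - exp (c * ?z l) * ?h)
        \<le> (\<Sum>l<Suc m. ?h * (exp (c * ?z (Suc l)) - exp (c * ?z l)))"
      using t by (intro sum_mono) blast
    moreover have "\<dots> = ?h * (exp (c * b) - exp (c * a))"
      unfolding sum_distrib_left[symmetric] sum_exp_partition ..
    moreover have "?h * (exp (c * b) - exp (c * a)) = ((b - a) * (exp (c * b) - exp (c * a))) * inverse (real (Suc m))"
      by (simp add: field_simps)
    ultimately show ?thesis by linarith
  qed
  have "(\<lambda>m. ((b - a) * (exp (c * b) - exp (c * a))) * inverse (real (Suc m))) \<longlonglongrightarrow> 0"
    using tendsto_mult_right_zero[OF LIMSEQ_inverse_real_of_nat] by auto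
  then have "(\<lambda>m. ?I - ?S m) \<longlonglongrightarrow> 0"
    by (rule Lim_null_comparison[rotated]) (use bnd in auto)
  from tendsto_diff[OF tendsto_const[of ?I] this] show ?thesis by simp
qed

text \<open>A pathwise form of \<open>d(e\<^bsup>\<theta>t\<^esup> X) = \<sigma> e\<^bsup>\<theta>t\<^esup> dW\<close>. In each subinterval the equation replaces the
  increment of \<open>W\<close> by one of \<open>X\<close> plus a drift integral; what is left over is controlled by the
  uniform continuity of the path. The sums are linear in the increments of \<open>W\<close>, whose joint law
  is known.\<close>

lemma ou_path_increment_limit:
  fixes X W :: "real \<Rightarrow> real"
  assumes \<theta>: "\<theta> > 0" and cont: "continuous_on {0..T} X" and ab: "0 \<le> a" "a \<le> b" "b \<le> T"
    and sde: "\<And>t. t \<in> {0..T} \<Longrightarrow> X t = X 0 + (LBINT s:{0..t}. - \<theta> * X s) + \<sigma> * W t"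
  shows "(\<lambda>m. \<Sum>l<Suc m. \<sigma> * exp (\<theta> * part_pt a b (Suc m) l) * (W (part_pt a b (Suc m) (Suc l)) - W (part_pt a b (Suc m) l)))
    \<longlonglongrightarrow> exp (\<theta> * b) * X b - exp (\<theta> * a) * X a" (is "?S \<longlonglongrightarrow> ?I")
proof -
  have conts: "continuous_on {u..v} X" if "0 \<le> u" "v \<le> T" for u v
    by (rule continuous_on_subset[OF cont]) (use that in auto)
  have incr: "\<sigma> * (W v - W u) = X v - X u + \<theta> * integral {u..v} X" if uv: "0 \<le> u" "u \<le> v" "v \<le> T" for u v
  proof -
    have L: "(LBINT s:{0..t}. - \<theta> * X s) = - \<theta> * integral {0..t} X" if "t \<in> {0..T}" for t
    proof -
      have "set_integrable lborel {0..t} X"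
        using that by (intro borel_integrable_atLeastAtMost' conts) auto
      then show ?thesis unfolding set_integral_mult_right
        using set_borel_integral_eq_integral(2)[of "{0..t}" X] by simp
    qed
    have "integral {0..u} X + integral {u..v} X = integral {0..v} X"
      using uv by (intro Henstock_Kurzweil_Integration.integral_combine integrable_continuous_real conts) auto
    then have eq: "integral {u..v} X = integral {0..v} X - integral {0..u} X" by simp
    show ?thesis unfolding eq using sde[of u] sde[of v] L[of u] L[of v] uv by (simp add: algebra_simps)
  qed
  have "bounded (X ` {0..T})"
    by (rule compact_imp_bounded[OF compact_continuous_image[OF cont compact_Icc]])
  then obtain K where "\<forall>y\<in>X ` {0..T}. norm y \<le> K"
    unfolding bounded_iff by blast
  then have K: "\<bar>X t\<bar> \<le> K" if "t \<in> {0..T}" for t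
    using that by simp
  have K0: "K \<ge> 0" using K[of a] ab by force
  show ?thesis
  proof (rule LIMSEQ_I)
    fix r :: real assume r: "r > 0"
    \<comment> \<open>\<open>C - 1\<close> is the factor of \<open>\<epsilon>\<close> in the total error; adding 1 makes the divisor positive\<close>
    define C where "C = \<theta> * K * (exp (\<theta> * b) - exp (\<theta> * a)) + \<theta> * exp (\<theta> * T) * (b - a) + 1"
    have eab: "exp (\<theta> * a) \<le> exp (\<theta> * b)" using \<theta> ab by simp
    have C: "C > 0" unfolding C_def using \<theta> K0 eab ab by (intro add_nonneg_pos add_nonneg_nonneg mult_nonneg_nonneg) auto
    define \<epsilon> where "\<epsilon> = r / (2 * C)"
    have \<epsilon>: "\<epsilon> > 0" using r C by (simp add: \<epsilon>_def)
    have "uniformly_continuous_on {0..T} X"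
      by (rule compact_uniformly_continuous[OF cont]) simp
    then obtain \<delta> where \<delta>: "\<delta> > 0" "\<And>x y. x \<in> {0..T} \<Longrightarrow> y \<in> {0..T} \<Longrightarrow> dist y x < \<delta> \<Longrightarrow> dist (X y) (X x) < \<epsilon>"
      unfolding uniformly_continuous_on_def using \<epsilon> by metis
    define \<eta> where "\<eta> = min \<delta> \<epsilon>"
    have \<eta>: "\<eta> > 0" using \<delta> \<epsilon> by (simp add: \<eta>_def)
    obtain m0 :: nat where m0: "(b - a) / \<eta> < real m0" using reals_Archimedean2 by blast
    show "\<exists>no. \<forall>m\<ge>no. norm (?S m - ?I) < r"
    proof (intro exI allI impI)
      fix m assume m: "m \<ge> m0"
      let ?z = "part_pt a b (Suc m)"
      define h where "h = (b - a) / Suc m"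
      have h: "h < \<eta>" "h \<ge> 0"
      proof -
        have "(b - a) / \<eta> < real (Suc m)" using m0 m by linarith
        then show "h < \<eta>" using \<eta> by (simp add: h_def field_simps)
        show "h \<ge> 0" using ab by (simp add: h_def)
      qed
      have zd: "?z (Suc l) - ?z l = h" for l by (simp add: part_pt_diff h_def)
      define err where "err l = exp (\<theta> * ?z (Suc l)) * X (?z (Suc l)) - exp (\<theta> * ?z l) * X (?z l) -
          \<sigma> * exp (\<theta> * ?z l) * (W (?z (Suc l)) - W (?z l))" for l
      have err: "\<bar>err l\<bar> \<le> \<epsilon> * \<theta> * K * (exp (\<theta> * ?z (Suc l)) - exp (\<theta> * ?z l)) + \<epsilon> * \<theta> * exp (\<theta> * T) * h" if l: "l < Suc m" for l
      proof -
        let ?u = "?z l" and ?v = "?z (Suc l)"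
        have uv: "0 \<le> ?u" "?u \<le> ?v" "?v \<le> T"
          using part_pt_bounds[OF ab(2), of l "Suc m"] part_pt_bounds[OF ab(2), of "Suc l" "Suc m"]
            part_pt_mono[OF ab(2), of "Suc m" l] l ab by auto
        have "?v - ?u = h" by (rule zd)
        define J where "J = integral {?u..?v} (\<lambda>s. X ?v - X s)"
        have J: "integral {?u..?v} X = h * X ?v - J"
        proof -
          have "J = integral {?u..?v} (\<lambda>s. X ?v) - integral {?u..?v} X"
            unfolding J_def using uv
            by (intro Henstock_Kurzweil_Integration.integral_diff integrable_continuous_real conts continuous_intros) auto
          then show ?thesis using uv zd[of l] by simp
        qed
        have "norm J \<le> \<epsilon> * (?v - ?u)"
          unfolding J_def
        proof (rule integral_bound)
          fix s assume s: "s \<in> {?u..?v}"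
          then have "dist ?v s < \<delta>" using zd[of l] h by (auto simp: dist_real_def \<eta>_def)
          then have "dist (X ?v) (X s) < \<epsilon>" using \<delta>(2)[of s ?v] s uv by auto
          then show "norm (X ?v - X s) \<le> \<epsilon>" by (simp add: dist_real_def)
        qed (use uv in \<open>auto intro!: continuous_intros conts\<close>)
        then have J': "\<bar>J\<bar> \<le> \<epsilon> * h" using zd[of l] by simp
        have "err l = exp (\<theta> * ?v) * X ?v - exp (\<theta> * ?u) * X ?u - exp (\<theta> * ?u) * (\<sigma> * (W ?v - W ?u))"
          by (simp add: err_def)
        also have "\<dots> = (exp (\<theta> * ?v) - exp (\<theta> * ?u) - \<theta> * exp (\<theta> * ?u) * h) * X ?v + \<theta> * exp (\<theta> * ?u) * J"
          unfolding incr[OF uv] J by (simp add: algebra_simps)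
        finally have eq: "err l = (exp (\<theta> * ?v) - exp (\<theta> * ?u) - \<theta> * exp (\<theta> * ?u) * h) * X ?v + \<theta> * exp (\<theta> * ?u) * J" .
        note eb = exp_increment_bounds[OF \<theta> uv(2), unfolded zd]
        have lo: "0 \<le> exp (\<theta> * ?v) - exp (\<theta> * ?u) - \<theta> * exp (\<theta> * ?u) * h" using eb by simp
        have "exp (\<theta> * ?v) - exp (\<theta> * ?u) - \<theta> * exp (\<theta> * ?u) * h \<le> (\<theta> * h) * (exp (\<theta> * ?v) - exp (\<theta> * ?u))"
          using eb by (simp add: algebra_simps)
        also have "\<dots> \<le> (\<theta> * \<epsilon>) * (exp (\<theta> * ?v) - exp (\<theta> * ?u))"
          using h \<theta> uv by (intro mult_right_mono mult_left_mono) (auto simp: \<eta>_def)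
        finally have "\<bar>(exp (\<theta> * ?v) - exp (\<theta> * ?u) - \<theta> * exp (\<theta> * ?u) * h) * X ?v\<bar> \<le>
            (\<theta> * \<epsilon>) * (exp (\<theta> * ?v) - exp (\<theta> * ?u)) * K"
          unfolding abs_mult using lo K[of ?v] uv by (intro mult_mono) auto
        moreover have "\<bar>\<theta> * exp (\<theta> * ?u) * J\<bar> \<le> \<theta> * exp (\<theta> * T) * (\<epsilon> * h)"
          unfolding abs_mult using J' \<theta> uv by (intro mult_mono) auto
        ultimately show ?thesis unfolding eq by (intro order.trans[OF abs_triangle_ineq]) (simp add: mult_ac)
      qed
      have tel: "?I = (\<Sum>l<Suc m. exp (\<theta> * ?z (Suc l)) * X (?z (Suc l)) - exp (\<theta> * ?z l) * X (?z l))"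
        using sum_lessThan_telescope[of "\<lambda>l. exp (\<theta> * ?z l) * X (?z l)" "Suc m"] by simp
      have "?I - ?S m = (\<Sum>l<Suc m. err l)"
        unfolding tel err_def sum_subtractf ..
      then have "norm (?S m - ?I) = \<bar>\<Sum>l<Suc m. err l\<bar>" by (simp add: abs_minus_commute)
      also have "\<dots> \<le> (\<Sum>l<Suc m. \<bar>err l\<bar>)" by (rule sum_abs)
      also have "\<dots> \<le> (\<Sum>l<Suc m. \<epsilon> * \<theta> * K * (exp (\<theta> * ?z (Suc l)) - exp (\<theta> * ?z l)) + \<epsilon> * \<theta> * exp (\<theta> * T) * h)"
        using err by (intro sum_mono) auto
      also have "\<dots> = \<epsilon> * \<theta> * K * (exp (\<theta> * b) - exp (\<theta> * a)) + Suc m * (\<epsilon> * \<theta> * exp (\<theta> * T) * h)"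
        unfolding sum.distrib sum_distrib_left[symmetric] sum_exp_partition by simp
      also have "Suc m * (\<epsilon> * \<theta> * exp (\<theta> * T) * h) = \<epsilon> * \<theta> * exp (\<theta> * T) * (b - a)"
        by (simp add: h_def)
      also have "\<epsilon> * \<theta> * K * (exp (\<theta> * b) - exp (\<theta> * a)) + \<epsilon> * \<theta> * exp (\<theta> * T) * (b - a) = \<epsilon> * (C - 1)"
        by (simp add: C_def algebra_simps)
      also have "\<dots> \<le> \<epsilon> * C" using \<epsilon> by simp
      also have "\<dots> = r / 2" using C by (simp add: \<epsilon>_def)
      also have "\<dots> < r" using r by simp
      finally show "norm (?S m - ?I) < r" .
    qed
  qed
qed

section \<open>The rescaled process and its increments\<close>

locale ornstein_uhlenbeck = prob_space M for M :: "'w measure" +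
  fixes T \<theta> \<sigma> \<sigma>0 :: real and W X :: "real \<Rightarrow> 'w \<Rightarrow> real"
  assumes T_pos: "T > 0" and \<theta>_pos: "\<theta> > 0" and \<sigma>_nonneg: "\<sigma> \<ge> 0" and \<sigma>0_nonneg: "\<sigma>0 \<ge> 0"
    and brownian: "brownian_motion_on T M W"
    and sde: "solves_additive_sde T M W (\<lambda>x. - \<theta> * x) \<sigma> X"
    and initial: "distr M borel (X 0) = centred_normal \<sigma>0"
    and initial_indep: "indep_of_process T M (X 0) W"
begin

definition Y :: "real \<Rightarrow> 'w \<Rightarrow> real" where
  "Y t x = exp (\<theta> * t) * X t x"

text \<open>The variance of an increment of \<open>Y\<close> is \<open>\<sigma>\<^sup>2\<close> times the increment of this function.\<close>

definition clock :: "real \<Rightarrow> real" where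
  "clock t = exp (2 * \<theta> * t) / (2 * \<theta>)"

lemma clock_strict_mono: "s < t \<Longrightarrow> clock s < clock t"
  using \<theta>_pos by (simp add: clock_def divide_strict_right_mono)

lemma clock_mono: "s \<le> t \<Longrightarrow> clock s \<le> clock t"
  using \<theta>_pos by (simp add: clock_def divide_right_mono)

lemma X_measurable: "t \<in> {0..T} \<Longrightarrow> random_variable borel (X t)"
  using sde by (auto simp: solves_additive_sde_def)

lemma Y_measurable: "t \<in> {0..T} \<Longrightarrow> random_variable borel (Y t)"
  unfolding Y_def by (intro borel_measurable_times X_measurable) auto

lemma W_measurable: "t \<in> {0..T} \<Longrightarrow> random_variable borel (W t)"
  using brownian unfolding brownian_motion_on_def by (elim conjE) (erule bspec)

lemma X_continuous: "x \<in> space M \<Longrightarrow> continuous_on {0..T} (\<lambda>t. X t x)"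
  using sde by (auto simp: solves_additive_sde_def)

lemma W_increment_distr:
  assumes "0 \<le> s" "s \<le> t" "t \<le> T"
  shows "distr M borel (\<lambda>x. W t x - W s x) = centred_normal (sqrt (t - s))"
proof (cases "s = t")
  case True
  then show ?thesis by (simp add: centred_normal_def)
next
  case False
  then have "s < t" "s \<in> {0..T}" "t \<in> {0..T}" using assms by auto
  moreover have "\<forall>s\<in>{0..T}. \<forall>t\<in>{0..T}. s < t \<longrightarrow>
      distr M borel (\<lambda>x. W t x - W s x) = centred_normal (sqrt (t - s))"
    using brownian unfolding brownian_motion_on_def by (elim conjE)
  ultimately show ?thesis by (elim ballE impE) auto
qed

lemma W_increments_indep:
  assumes "\<And>k. k \<le> m \<Longrightarrow> 0 \<le> s k \<and> s k \<le> T" "\<And>k. k < m \<Longrightarrow> s k \<le> s (Suc k)"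
  shows "indep_vars (\<lambda>_. borel) (\<lambda>k x. W (s (Suc k)) x - W (s k) x) {..<m}"
proof -
  have "\<forall>(m::nat) s. (\<forall>k\<le>m. s k \<in> {0..T}) \<and> (\<forall>k<m. s k \<le> s (Suc k)) \<longrightarrow>
      indep_vars (\<lambda>_. borel) (\<lambda>k x. W (s (Suc k)) x - W (s k) x) {..<m}"
    using brownian unfolding brownian_motion_on_def by (elim conjE)
  then have "(\<forall>k\<le>m. s k \<in> {0..T}) \<and> (\<forall>k<m. s k \<le> s (Suc k)) \<longrightarrow>
      indep_vars (\<lambda>_. borel) (\<lambda>k x. W (s (Suc k)) x - W (s k) x) {..<m}"
    by (elim allE)
  moreover have "(\<forall>k\<le>m. s k \<in> {0..T}) \<and> (\<forall>k<m. s k \<le> s (Suc k))"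
    using assms by simp
  ultimately show ?thesis by (rule mp)
qed

definition euler_sum :: "real \<Rightarrow> real \<Rightarrow> nat \<Rightarrow> 'w \<Rightarrow> real" where
  "euler_sum a b m x = (\<Sum>l<Suc m. \<sigma> * exp (\<theta> * part_pt a b (Suc m) l) *
     (W (part_pt a b (Suc m) (Suc l)) x - W (part_pt a b (Suc m) l) x))"

lemma part_pt_in_range:
  assumes "0 \<le> a" "a \<le> b" "b \<le> T" "l \<le> Suc m"
  shows "0 \<le> part_pt a b (Suc m) l" "part_pt a b (Suc m) l \<le> T"
  using part_pt_bounds[of a b l "Suc m"] assms by auto

lemma euler_sum_tendsto:
  assumes "0 \<le> a" "a \<le> b" "b \<le> T"
  shows "AE x in M. (\<lambda>m. euler_sum a b m x) \<longlonglongrightarrow> Y b x - Y a x"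
proof -
  have "AE x in M. \<forall>t\<in>{0..T}. X t x = X 0 x + (LBINT s:{0..t}. - \<theta> * X s x) + \<sigma> * W t x"
    using sde unfolding solves_additive_sde_def by (elim conjE)
  then show ?thesis
    using AE_space
  proof eventually_elim
    case (elim x)
    then show ?case
      unfolding euler_sum_def Y_def
      by (intro ou_path_increment_limit[OF \<theta>_pos X_continuous[OF elim(2)] assms]) (erule bspec[OF elim(1)])
  qed
qed

lemma euler_sum_measurable:
  assumes "0 \<le> a" "a \<le> b" "b \<le> T"
  shows "random_variable borel (euler_sum a b m)"
  unfolding euler_sum_def
  by (intro borel_measurable_sum borel_measurable_times borel_measurable_diff W_measurable)
     (use part_pt_in_range[OF assms] in auto)

lemma char_euler_sum:
  assumes ab: "0 \<le> a" "a \<le> b" "b \<le> T"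
  shows "char (distr M borel (euler_sum a b m)) \<xi> = complex_of_real (exp (- (\<sigma>\<^sup>2 *
    (\<Sum>l<Suc m. exp (2 * \<theta> * part_pt a b (Suc m) l) * (part_pt a b (Suc m) (Suc l) - part_pt a b (Suc m) l)) * \<xi>\<^sup>2) / 2))"
proof -
  let ?z = "part_pt a b (Suc m)"
  define I where "I l x = W (?z (Suc l)) x - W (?z l) x" for l x
  define w where "w l = \<sigma> * exp (\<theta> * ?z l)" for l
  note rng = part_pt_in_range[OF ab]
  have ind: "indep_vars (\<lambda>_. borel) I {..<Suc m}"
    unfolding I_def by (rule W_increments_indep) (use rng part_pt_mono[OF ab(2)] in auto)
  have Im: "random_variable borel (I l)" if "l < Suc m" for l
    using ind that by (auto simp: indep_vars_def)
  have ind': "indep_vars (\<lambda>_. borel) (\<lambda>l x. w l * I l x) {..<Suc m}"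
    using indep_vars_compose2[OF ind, of "\<lambda>l y. w l * y" "\<lambda>_. borel"] by simp
  have "euler_sum a b m = (\<lambda>x. \<Sum>l<Suc m. w l * I l x)"
    by (simp add: euler_sum_def w_def I_def fun_eq_iff)
  then have "char (distr M borel (euler_sum a b m)) \<xi> = (\<Prod>l<Suc m. char (distr M borel (\<lambda>x. w l * I l x)) \<xi>)"
    using char_distr_sum[OF ind', of \<xi>] by simp
  also have "\<dots> = (\<Prod>l<Suc m. complex_of_real (exp (- (\<sigma>\<^sup>2 * (exp (2 * \<theta> * ?z l) * (?z (Suc l) - ?z l)) * \<xi>\<^sup>2) / 2)))"
  proof (rule prod.cong[OF refl])
    fix l assume "l \<in> {..<Suc m}"
    then have l: "l < Suc m" by simp
    have le: "?z l \<le> ?z (Suc l)" by (rule part_pt_mono[OF ab(2)])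
    have "char (distr M borel (\<lambda>x. w l * I l x)) \<xi> = char (distr M borel (I l)) (w l * \<xi>)"
      unfolding char_def using Im[OF l] by (subst (1 2) integral_distr) (auto simp: mult_ac)
    also have "distr M borel (I l) = centred_normal (sqrt (?z (Suc l) - ?z l))"
      unfolding I_def by (rule W_increment_distr) (use rng[of l] rng[of "Suc l"] l le in auto)
    also have "char \<dots> (w l * \<xi>) = complex_of_real (exp (- ((?z (Suc l) - ?z l) * (w l * \<xi>)\<^sup>2) / 2))"
      using le by (subst char_centred_normal) auto
    also have "(w l)\<^sup>2 = \<sigma>\<^sup>2 * exp (2 * \<theta> * ?z l)"
      by (simp add: w_def power_mult_distrib exp_double mult.assoc)
    then have "(?z (Suc l) - ?z l) * (w l * \<xi>)\<^sup>2 = \<sigma>\<^sup>2 * (exp (2 * \<theta> * ?z l) * (?z (Suc l) - ?z l)) * \<xi>\<^sup>2"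
      by (simp add: power_mult_distrib mult_ac)
    finally show "char (distr M borel (\<lambda>x. w l * I l x)) \<xi> =
        complex_of_real (exp (- (\<sigma>\<^sup>2 * (exp (2 * \<theta> * ?z l) * (?z (Suc l) - ?z l)) * \<xi>\<^sup>2) / 2))" .
  qed
  also have "\<dots> = complex_of_real (exp (\<Sum>l<Suc m. - (\<sigma>\<^sup>2 * (exp (2 * \<theta> * ?z l) * (?z (Suc l) - ?z l)) * \<xi>\<^sup>2) / 2))"
    by (subst exp_sum) (simp_all del: prod.lessThan_Suc)
  also have "(\<Sum>l<Suc m. - (\<sigma>\<^sup>2 * (exp (2 * \<theta> * ?z l) * (?z (Suc l) - ?z l)) * \<xi>\<^sup>2) / 2) =
     - (\<sigma>\<^sup>2 * (\<Sum>l<Suc m. exp (2 * \<theta> * ?z l) * (?z (Suc l) - ?z l)) * \<xi>\<^sup>2) / 2"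
    unfolding sum_distrib_left sum_distrib_right sum_negf[symmetric] sum_divide_distrib ..
  finally show ?thesis .
qed

text \<open>The characteristic functions of the approximating sums contain Riemann sums for the
  integral of \<open>e\<^bsup>2\<theta>t\<^esup>\<close>, that is, for the increment of \<open>clock\<close>.\<close>

lemma Y_increment_distr:
  assumes ab: "0 \<le> a" "a \<le> b" "b \<le> T"
  shows "distr M borel (\<lambda>x. Y b x - Y a x) = centred_normal (\<sigma> * sqrt (clock b - clock a))"
proof (rule Levy_uniqueness)
  have [measurable]: "random_variable borel (Y a)" "random_variable borel (Y b)"
    by (intro Y_measurable; use ab in simp)+
  show "real_distribution (distr M borel (\<lambda>x. Y b x - Y a x))" by simp
  have nn: "clock b - clock a \<ge> 0" using clock_mono ab by simp
  then have sd: "\<sigma> * sqrt (clock b - clock a) \<ge> 0" using \<sigma>_nonneg by simp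
  then show "real_distribution (centred_normal (\<sigma> * sqrt (clock b - clock a)))"
    by (rule centred_normal_real_distribution)
  show "char (distr M borel (\<lambda>x. Y b x - Y a x)) = char (centred_normal (\<sigma> * sqrt (clock b - clock a)))"
  proof
    fix \<xi>
    have Em[measurable]: "random_variable borel (euler_sum a b m)" for m
      by (rule euler_sum_measurable[OF ab])
    have "(\<lambda>m. \<integral>x. iexp (\<xi> * euler_sum a b m x) \<partial>M) \<longlonglongrightarrow> (\<integral>x. iexp (\<xi> * (Y b x - Y a x)) \<partial>M)"
    proof (rule integral_dominated_convergence[where w="\<lambda>_. 1"])
      show "AE x in M. (\<lambda>m. iexp (\<xi> * euler_sum a b m x)) \<longlonglongrightarrow> iexp (\<xi> * (Y b x - Y a x))"
        using euler_sum_tendsto[OF ab] by eventually_elim (intro tendsto_intros)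
    qed auto
    then have "(\<lambda>m. char (distr M borel (euler_sum a b m)) \<xi>) \<longlonglongrightarrow> char (distr M borel (\<lambda>x. Y b x - Y a x)) \<xi>"
      unfolding char_def by (simp add: integral_distr)
    moreover have "(\<lambda>m. char (distr M borel (euler_sum a b m)) \<xi>) \<longlonglongrightarrow>
        complex_of_real (exp (- (\<sigma>\<^sup>2 * ((exp (2 * \<theta> * b) - exp (2 * \<theta> * a)) / (2 * \<theta>)) * \<xi>\<^sup>2) / 2))"
      unfolding char_euler_sum[OF ab]
      using \<theta>_pos ab by (intro tendsto_intros exp_riemann_sum) auto
    ultimately have "char (distr M borel (\<lambda>x. Y b x - Y a x)) \<xi> =
       complex_of_real (exp (- (\<sigma>\<^sup>2 * ((exp (2 * \<theta> * b) - exp (2 * \<theta> * a)) / (2 * \<theta>)) * \<xi>\<^sup>2) / 2))"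
      by (rule LIMSEQ_unique)
    also have "\<sigma>\<^sup>2 * ((exp (2 * \<theta> * b) - exp (2 * \<theta> * a)) / (2 * \<theta>)) = (\<sigma> * sqrt (clock b - clock a))\<^sup>2"
      using nn by (simp add: power_mult_distrib clock_def diff_divide_distrib)
    finally show "char (distr M borel (\<lambda>x. Y b x - Y a x)) \<xi> = char (centred_normal (\<sigma> * sqrt (clock b - clock a))) \<xi>"
      by (simp only: char_centred_normal[OF sd])
  qed
qed

definition W_algebra :: "'w measure" where
  "W_algebra = vimage_algebra (space M) (\<lambda>x. \<lambda>t\<in>{0..T}. W t x) (Pi\<^sub>M {0..T} (\<lambda>_. borel))"

lemma W_algebra_subalgebra: "subalgebra M W_algebra"
  unfolding subalgebra_def W_algebra_def
  by (intro conjI sets_image_in_sets measurable_restrict W_measurable) auto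

lemma W_measurable_W_algebra:
  assumes "t \<in> {0..T}"
  shows "W t \<in> borel_measurable W_algebra"
proof -
  have "(\<lambda>x. \<lambda>t\<in>{0..T}. W t x) \<in> measurable W_algebra (Pi\<^sub>M {0..T} (\<lambda>_. borel))"
    unfolding W_algebra_def by (rule measurable_vimage_algebra1) (auto simp: space_PiM)
  from measurable_compose[OF this measurable_component_singleton[OF assms]]
  show ?thesis using assms by simp
qed

lemma euler_sum_measurable_W_algebra:
  assumes "0 \<le> a" "a \<le> b" "b \<le> T"
  shows "euler_sum a b m \<in> borel_measurable W_algebra"
  unfolding euler_sum_def
  by (intro borel_measurable_sum borel_measurable_times borel_measurable_diff W_measurable_W_algebra)
     (use part_pt_in_range[OF assms] in auto)

text \<open>Cutting each interval of the schedule into \<open>Suc m\<close> equal pieces gives one ordered list of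
  points, whose Brownian increments are independent; the sums in question use disjoint blocks of
  that list. The point with number \<open>i\<close> lies in the interval \<open>i div Suc m\<close>.\<close>

lemma euler_sums_indep:
  assumes p: "\<And>k. k \<le> N \<Longrightarrow> 0 \<le> p k \<and> p k \<le> T" "\<And>k. k < N \<Longrightarrow> p k \<le> p (Suc k)"
  shows "indep_vars (\<lambda>_. borel) (\<lambda>k. euler_sum (p k) (p (Suc k)) m) {..<N}"
proof -
  define q where "q = Suc m"
  define z where "z i = part_pt (p (i div q)) (p (Suc (i div q))) q (i mod q)" for i
  have q: "q > 0" by (simp add: q_def)
  have z_blk: "z (k * q + l) = part_pt (p k) (p (Suc k)) q l" if "l \<le> q" for k l
  proof (cases "l = q")
    case True
    have "(k * q + q) div q = Suc k" "(k * q + q) mod q = 0" using q by simp_all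
    then show ?thesis unfolding True z_def using q by simp
  next
    case False
    then have "l < q" using that by simp
    then have "(k * q + l) div q = k" "(k * q + l) mod q = l" by auto
    then show ?thesis by (simp add: z_def)
  qed
  have dec: "\<exists>k<N. \<exists>l<q. i = k * q + l" if "i < N * q" for i
  proof (intro exI conjI)
    show "i div q < N" using that by (simp add: less_mult_imp_div_less)
    show "i mod q < q" using q by simp
    show "i = i div q * q + i mod q" by simp
  qed
  have zr: "0 \<le> z i \<and> z i \<le> T" if "i \<le> N * q" for i
  proof (cases "i = N * q")
    case True
    then show ?thesis using p(1)[of N] z_blk[of 0 N] by simp
  next
    case False
    with that have "i < N * q" by simp
    from dec[OF this] obtain k l where kl: "k < N" "l < q" "i = k * q + l" by blast
    have "p k \<le> part_pt (p k) (p (Suc k)) q l" "part_pt (p k) (p (Suc k)) q l \<le> p (Suc k)"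
      using part_pt_bounds[OF p(2)[OF kl(1)], of l q] kl by simp_all
    moreover have "0 \<le> p k" "p (Suc k) \<le> T" using p(1)[of k] p(1)[of "Suc k"] kl by simp_all
    moreover have "z i = part_pt (p k) (p (Suc k)) q l" unfolding kl(3) by (rule z_blk) (use kl in simp)
    ultimately show ?thesis by simp
  qed
  have zm: "z i \<le> z (Suc i)" if "i < N * q" for i
  proof -
    from dec[OF that] obtain k l where kl: "k < N" "l < q" "i = k * q + l" by blast
    have "z i = part_pt (p k) (p (Suc k)) q l" unfolding kl(3) by (rule z_blk) (use kl in simp)
    moreover have "z (Suc i) = part_pt (p k) (p (Suc k)) q (Suc l)"
      unfolding kl(3) add_Suc_right[symmetric] by (rule z_blk) (use kl in simp)
    ultimately show ?thesis using part_pt_mono[OF p(2)[OF kl(1)], of q l] by simp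
  qed
  define K where "K k = {k * q..<k * q + q}" for k
  define G where "G k f = (\<Sum>i\<in>K k. \<sigma> * exp (\<theta> * z i) * f i)" for k and f :: "nat \<Rightarrow> real"
  have ind: "indep_vars (\<lambda>_. borel) (\<lambda>i x. W (z (Suc i)) x - W (z i) x) {..<N * q}"
    by (rule W_increments_indep) (use zr zm in auto)
  have "indep_vars (\<lambda>k. PiM (K k) (\<lambda>_. borel)) (\<lambda>k x. restrict (\<lambda>i. W (z (Suc i)) x - W (z i) x) (K k)) {..<N}"
  proof (rule indep_vars_restrict[OF ind])
    fix k assume "k \<in> {..<N}"
    then have "Suc k * q \<le> N * q" by (intro mult_le_mono1) simp
    then show "K k \<subseteq> {..<N * q}" by (auto simp: K_def)
  next
    show "disjoint_family_on K {..<N}"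
      unfolding disjoint_family_on_def
    proof (intro ballI impI)
      fix j k :: nat assume "j \<noteq> k"
      have K_div: "i div q = k" if "i \<in> K k" for i k
      proof -
        define l where "l = i - k * q"
        have "i = k * q + l" "l < q"
          using that by (auto simp: K_def l_def)
        then show ?thesis by simp
      qed
      show "K j \<inter> K k = {}"
      proof (rule equals0I)
        fix i assume "i \<in> K j \<inter> K k"
        then show False using K_div[of i j] K_div[of i k] \<open>j \<noteq> k\<close> by simp
      qed
    qed
  qed
  from indep_vars_compose2[OF this, of G "\<lambda>_. borel"]
  have ind2: "indep_vars (\<lambda>_. borel) (\<lambda>k x. G k (restrict (\<lambda>i. W (z (Suc i)) x - W (z i) x) (K k))) {..<N}"
    unfolding G_def by simp
  have "G k (restrict (\<lambda>i. W (z (Suc i)) x - W (z i) x) (K k)) = euler_sum (p k) (p (Suc k)) m x" for k x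
  proof -
    have "G k (restrict (\<lambda>i. W (z (Suc i)) x - W (z i) x) (K k)) = (\<Sum>i\<in>K k. \<sigma> * exp (\<theta> * z i) * (W (z (Suc i)) x - W (z i) x))"
      unfolding G_def by (intro sum.cong) auto
    also have "\<dots> = (\<Sum>l<q. \<sigma> * exp (\<theta> * z (k * q + l)) * (W (z (Suc (k * q + l))) x - W (z (k * q + l)) x))"
      using sum.shift_bounds_nat_ivl[of "\<lambda>i. \<sigma> * exp (\<theta> * z i) * (W (z (Suc i)) x - W (z i) x)" 0 "k * q" q]
      by (simp add: K_def lessThan_atLeast0 add.commute)
    also have "\<dots> = euler_sum (p k) (p (Suc k)) m x"
      unfolding euler_sum_def q_def[symmetric]
    proof (rule sum.cong[OF refl])
      fix l assume "l \<in> {..<q}"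
      then show "\<sigma> * exp (\<theta> * z (k * q + l)) * (W (z (Suc (k * q + l))) x - W (z (k * q + l)) x) =
         \<sigma> * exp (\<theta> * part_pt (p k) (p (Suc k)) q l) * (W (part_pt (p k) (p (Suc k)) q (Suc l)) x - W (part_pt (p k) (p (Suc k)) q l) x)"
        using z_blk[of l k] z_blk[of "Suc l" k] by simp
    qed
    finally show ?thesis .
  qed
  then show ?thesis using ind2 by simp
qed

text \<open>The approximating sums are measurable with respect to the sigma-algebra of the Brownian path,
  of which the initial value is independent; the joint independence passes to their limits.\<close>

lemma initial_and_Y_increments_indep:
  assumes p: "\<And>k. k \<le> N \<Longrightarrow> 0 \<le> p k \<and> p k \<le> T" "\<And>k. k < N \<Longrightarrow> p k \<le> p (Suc k)"
  shows "indep_vars (\<lambda>_. borel) (case_nat (X 0) (\<lambda>k x. Y (p (Suc k)) x - Y (p k) x)) {..N}"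
proof (rule indep_vars_AE_limit)
  show "indep_vars (\<lambda>_. borel) (case_nat (X 0) (\<lambda>k. euler_sum (p k) (p (Suc k)) m)) {..N}" for m
  proof (rule indep_vars_case_nat)
    show "indep_set (sets (vimage_algebra (space M) (X 0) borel)) (sets W_algebra)"
      using initial_indep by (simp add: indep_of_process_def W_algebra_def)
    fix k assume "k < N"
    then show "euler_sum (p k) (p (Suc k)) m \<in> borel_measurable W_algebra"
      using p(1)[of k] p(1)[of "Suc k"] p(2)[of k] by (intro euler_sum_measurable_W_algebra) auto
  qed (use euler_sums_indep[of N p, OF p] W_algebra_subalgebra X_measurable[of 0] T_pos in auto)
  fix i assume i: "i \<in> {..N}"
  show "random_variable borel (case i of 0 \<Rightarrow> X 0 | Suc k \<Rightarrow> \<lambda>x. Y (p (Suc k)) x - Y (p k) x)"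
    using i p(1) X_measurable[of 0] T_pos Y_measurable by (auto split: nat.split intro!: borel_measurable_diff)
  show "AE x in M. (\<lambda>m. (case i of 0 \<Rightarrow> X 0 | Suc k \<Rightarrow> euler_sum (p k) (p (Suc k)) m) x)
      \<longlonglongrightarrow> (case i of 0 \<Rightarrow> X 0 | Suc k \<Rightarrow> \<lambda>x. Y (p (Suc k)) x - Y (p k) x) x"
  proof (cases i)
    case (Suc k)
    then show ?thesis using i p(1)[of k] p(1)[of "Suc k"] p(2)[of k] euler_sum_tendsto[of "p k" "p (Suc k)"] by auto
  qed simp
qed auto

end

section \<open>Orthogonality of the bridge residual to the observed dates\<close>

context ornstein_uhlenbeck
begin

definition bridge_weight :: "real \<Rightarrow> real \<Rightarrow> real \<Rightarrow> real" where
  "bridge_weight x u v = sinh (\<theta> * x) / sinh (\<theta> * (v - u))"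

lemma clock_diff: "clock v - clock s = exp (\<theta> * (v + s)) * sinh (\<theta> * (v - s)) / \<theta>"
proof -
  have "exp (2 * \<theta> * v) - exp (2 * \<theta> * s) = 2 * (exp (\<theta> * (v + s)) * sinh (\<theta> * (v - s)))"
    by (simp add: sinh_field_def right_diff_distrib exp_add[symmetric] exp_diff[symmetric] mult_exp_exp)
       (simp add: algebra_simps)
  then show ?thesis
    using \<theta>_pos by (simp add: clock_def diff_divide_distrib[symmetric])
qed

text \<open>In the clock of \<open>Y\<close>, interpolation of \<open>X\<close> by hyperbolic sines is the affine interpolation of
  \<open>Y\<close>; the residual is then the linear form of the Gaussian bridge in the two increments of
  \<open>Y\<close> on either side of \<open>s\<close>.\<close>

lemma bridge_residual:
  assumes "u < v"
  shows "X s x - (bridge_weight (v - s) u v * X u x + bridge_weight (s - u) u v * X v x) =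
    exp (- (\<theta> * s)) / (clock v - clock u) *
      ((clock v - clock s) * (Y s x - Y u x) - (clock s - clock u) * (Y v x - Y s x))"
proof -
  define c where "c = clock v - clock u"
  have c: "c > 0" using clock_strict_mono[OF assms] by (simp add: c_def)
  have sh: "sinh (\<theta> * (v - u)) \<noteq> 0" using \<theta>_pos assms by simp
  have X: "X t x = exp (- (\<theta> * t)) * Y t x" for t
    by (simp add: Y_def mult.assoc[symmetric] mult_exp_exp)
  have w1: "bridge_weight (v - s) u v * exp (- (\<theta> * u)) = exp (- (\<theta> * s)) * ((clock v - clock s) / c)"
  proof -
    have "exp (- (\<theta> * s)) * exp (\<theta> * (v + s)) = exp (- (\<theta> * u)) * exp (\<theta> * (v + u))"
      by (simp add: mult_exp_exp algebra_simps)
    then show ?thesis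
      unfolding bridge_weight_def c_def clock_diff using sh \<theta>_pos by (simp add: field_simps)
  qed
  have w2: "bridge_weight (s - u) u v * exp (- (\<theta> * v)) = exp (- (\<theta> * s)) * ((clock s - clock u) / c)"
  proof -
    have "exp (- (\<theta> * s)) * exp (\<theta> * (s + u)) = exp (- (\<theta> * v)) * exp (\<theta> * (v + u))"
      by (simp add: mult_exp_exp algebra_simps)
    then show ?thesis
      unfolding bridge_weight_def c_def clock_diff using sh \<theta>_pos by (simp add: field_simps)
  qed
  have "X s x - (bridge_weight (v - s) u v * X u x + bridge_weight (s - u) u v * X v x) =
     exp (- (\<theta> * s)) * Y s x - (bridge_weight (v - s) u v * exp (- (\<theta> * u)) * Y u x + bridge_weight (s - u) u v * exp (- (\<theta> * v)) * Y v x)"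
    unfolding X by (simp add: mult_ac)
  also have "\<dots> = exp (- (\<theta> * s)) * (Y s x - ((clock v - clock s) / c * Y u x + (clock s - clock u) / c * Y v x))"
    unfolding w1 w2 by (simp add: algebra_simps)
  also have "Y s x - ((clock v - clock s) / c * Y u x + (clock s - clock u) / c * Y v x) =
     ((clock v - clock s) * (Y s x - Y u x) - (clock s - clock u) * (Y v x - Y s x)) / c"
  proof -
    have "Y s x = (clock v - clock s + (clock s - clock u)) * Y s x / c" using c by (simp add: c_def)
    then show ?thesis by (simp add: diff_divide_distrib add_divide_distrib algebra_simps)
  qed
  finally show ?thesis by (simp add: c_def)
qed

lemma X_abs_moment:
  assumes s: "s \<in> {0..T}"
  shows "integrable M (X s)" "expectation (\<lambda>x. \<bar>X s x\<bar>) \<le> 2 + \<sigma>0\<^sup>2 + \<sigma>\<^sup>2 * clock T"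
proof -
  have s': "0 \<le> s" "s \<le> T" using s by auto
  have m0: "random_variable borel (X 0)" using X_measurable T_pos by simp
  have mY: "random_variable borel (\<lambda>x. Y s x - Y 0 x)"
    by (intro borel_measurable_diff Y_measurable) (use s in auto)
  note a0 = centred_normal_abs_moment[OF m0 initial \<sigma>0_nonneg]
  have nn: "0 \<le> clock s - clock 0" using clock_mono s' by simp
  have sd: "\<sigma> * sqrt (clock s - clock 0) \<ge> 0" using \<sigma>_nonneg nn by simp
  note aY = centred_normal_abs_moment[OF mY Y_increment_distr[OF _ s'] sd, simplified]
  have eq: "X s x = exp (- (\<theta> * s)) * (X 0 x + (Y s x - Y 0 x))" for x
    by (simp add: Y_def mult.assoc[symmetric] mult_exp_exp)
  show int: "integrable M (X s)"
    unfolding eq by (intro integrable_mult_right Bochner_Integration.integrable_add a0(1) aY(1))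
  have "expectation (\<lambda>x. \<bar>X s x\<bar>) \<le> expectation (\<lambda>x. \<bar>X 0 x\<bar> + \<bar>Y s x - Y 0 x\<bar>)"
  proof (rule integral_mono)
    show "integrable M (\<lambda>x. \<bar>X s x\<bar>)" using int by simp
    show "integrable M (\<lambda>x. \<bar>X 0 x\<bar> + \<bar>Y s x - Y 0 x\<bar>)" using a0(1) aY(1) by simp
    fix x
    have "\<bar>X s x\<bar> = exp (- (\<theta> * s)) * \<bar>X 0 x + (Y s x - Y 0 x)\<bar>"
      unfolding eq[of x] abs_mult by simp
    also have "\<dots> \<le> 1 * \<bar>X 0 x + (Y s x - Y 0 x)\<bar>"
      using \<theta>_pos s' by (intro mult_right_mono) auto
    also have "\<dots> \<le> \<bar>X 0 x\<bar> + \<bar>Y s x - Y 0 x\<bar>"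
      unfolding mult_1 by (rule abs_triangle_ineq)
    finally show "\<bar>X s x\<bar> \<le> \<bar>X 0 x\<bar> + \<bar>Y s x - Y 0 x\<bar>" .
  qed
  also have "\<dots> = expectation (\<lambda>x. \<bar>X 0 x\<bar>) + expectation (\<lambda>x. \<bar>Y s x - Y 0 x\<bar>)"
    using a0(1) aY(1) by simp
  also have "\<dots> \<le> (1 + \<sigma>0\<^sup>2) + (1 + (\<sigma> * sqrt (clock s - clock 0))\<^sup>2)"
    using a0(2) aY(2) by (intro add_mono) auto
  also have "(\<sigma> * sqrt (clock s - clock 0))\<^sup>2 \<le> \<sigma>\<^sup>2 * clock T"
  proof -
    have "clock 0 > 0" using \<theta>_pos by (simp add: clock_def)
    then have "clock s - clock 0 \<le> clock T" using clock_mono[OF s'(2)] by simp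
    then show ?thesis using nn by (simp add: power_mult_distrib mult_left_mono)
  qed
  finally show "expectation (\<lambda>x. \<bar>X s x\<bar>) \<le> 2 + \<sigma>0\<^sup>2 + \<sigma>\<^sup>2 * clock T" by simp
qed

lemma sigma_of_dates_subalgebra:
  assumes "\<And>j. j \<le> n \<Longrightarrow> r j \<in> {0..T}"
  shows "subalgebra M (sigma_of_dates M X n r)"
  unfolding subalgebra_def sigma_of_dates_def
  by (intro conjI sets_image_in_sets measurable_restrict X_measurable) (use assms in auto)

lemma X_measurable_sigma_of_dates:
  assumes "j \<le> n"
  shows "X (r j) \<in> borel_measurable (sigma_of_dates M X n r)"
proof -
  have "(\<lambda>x. \<lambda>j\<in>{0..n}. X (r j) x) \<in> measurable (sigma_of_dates M X n r) (Pi\<^sub>M {0..n} (\<lambda>_. borel))"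
    unfolding sigma_of_dates_def by (rule measurable_vimage_algebra1) (auto simp: space_PiM)
  from measurable_compose[OF this measurable_component_singleton[of j]]
  show ?thesis using assms by simp
qed

text \<open>The time \<open>s\<close> is inserted into the schedule. The observed values depend only on the initial
  value, the increments over the other intervals, and the sum of the two increments adjacent
  to \<open>s\<close>; the residual depends only on these two increments. Hence the Gaussian bridge
  and the extension to generated sigma-algebras apply.\<close>

lemma bridge_residual_orthogonal:
  assumes r0: "r 0 = 0" and rn: "r n = T" and mono: "\<And>k. k < n \<Longrightarrow> r k \<le> r (Suc k)"
    and j: "j < n" "r j < r (Suc j)" and s: "s \<in> {r j..r (Suc j)}"
    and A: "A \<in> sets (sigma_of_dates M X n r)"
  shows "expectation (\<lambda>x. (X s x - (bridge_weight (r (Suc j) - s) (r j) (r (Suc j)) * X (r j) x +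
      bridge_weight (s - r j) (r j) (r (Suc j)) * X (r (Suc j)) x)) * indicator A x) = 0"
proof -
  let ?u = "r j" and ?v = "r (Suc j)"
  \<comment> \<open>the schedule with \<open>s\<close> inserted at position \<open>Suc j\<close>\<close>
  define p where "p k = (if k \<le> j then r k else if k = Suc j then s else r (k - 1))" for k
  have rle: "r k \<le> r l" if "k \<le> l" "l \<le> n" for k l
    using that(1) that(2) by (induct rule: dec_induct) (use mono in \<open>auto intro: order.trans\<close>)
  have rr: "0 \<le> r k \<and> r k \<le> T" if "k \<le> n" for k
    using rle[of 0 k] rle[of k n] that r0 rn by auto
  have p_rng: "0 \<le> p k \<and> p k \<le> T" if "k \<le> Suc n" for k
    using rr[of j] rr[of "Suc j"] rr[of k] rr[of "k - 1"] s j that by (auto simp: p_def)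
  have p_mono: "p k \<le> p (Suc k)" if "k < Suc n" for k
    using mono[of k] mono[of "k - 1"] s j that by (cases k) (auto simp: p_def le_Suc_eq not_le)
  \<comment> \<open>index 0 is the initial value, so that partial sums of \<open>Z\<close> are the values of \<open>Y\<close>\<close>
  define Z where "Z = case_nat (X 0) (\<lambda>k x. Y (p (Suc k)) x - Y (p k) x)"
  have ind: "indep_vars (\<lambda>_. borel) Z {..Suc n}"
    unfolding Z_def by (rule initial_and_Y_increments_indep) (use p_rng p_mono in auto)
  have tel: "(\<Sum>l\<le>k. Z l x) = Y (p k) x" for k x
  proof (induct k)
    case 0
    have "p 0 = 0" using r0 by (simp add: p_def)
    then show ?case by (simp add: Z_def Y_def)
  qed (simp add: Z_def)
  define L where "L = {Suc j, Suc (Suc j)}"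
  define K where "K = {..Suc n} - L"
  have ZU: "Z (Suc j) = (\<lambda>x. Y s x - Y ?u x)" and ZV: "Z (Suc (Suc j)) = (\<lambda>x. Y ?v x - Y s x)"
    by (simp_all add: Z_def p_def)
  define a b where "a = sqrt (clock s - clock ?u)" and "b = sqrt (clock ?v - clock s)"
  have a2: "a\<^sup>2 = clock s - clock ?u" and b2: "b\<^sup>2 = clock ?v - clock s" and ab0: "a \<ge> 0" "b \<ge> 0"
    using clock_mono s by (auto simp: a_def b_def)
  have indUV: "indep_var borel (Z (Suc j)) borel (Z (Suc (Suc j)))"
  proof -
    have "indep_var (PiM {Suc j} (\<lambda>_. borel)) (\<lambda>x. restrict (\<lambda>i. Z i x) {Suc j})
        (PiM {Suc (Suc j)} (\<lambda>_. borel)) (\<lambda>x. restrict (\<lambda>i. Z i x) {Suc (Suc j)})"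
      by (rule indep_var_restrict[OF ind]) (use j in auto)
    from indep_var_compose[OF this, of "\<lambda>f. f (Suc j)" borel "\<lambda>f. f (Suc (Suc j))" borel]
    show ?thesis by (simp add: comp_def measurable_component_singleton)
  qed
  have distU: "distr M borel (Z (Suc j)) = centred_normal (\<sigma> * a)"
    unfolding ZU a_def by (rule Y_increment_distr) (use s rr[of j] rr[of "Suc j"] j in auto)
  have distV: "distr M borel (Z (Suc (Suc j))) = centred_normal (\<sigma> * b)"
    unfolding ZV b_def by (rule Y_increment_distr) (use s rr[of j] rr[of "Suc j"] j in auto)
  define g where "g q = b\<^sup>2 * q (Suc j) - a\<^sup>2 * q (Suc (Suc j))" for q :: "nat \<Rightarrow> real"
  define h where "h q = q (Suc j) + q (Suc (Suc j))" for q :: "nat \<Rightarrow> real"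
  define past_future where "past_future x = restrict (\<lambda>i. Z i x) K" for x
  define pair where "pair x = restrict (\<lambda>i. Z i x) L" for x
  have gp: "g (pair x) = b\<^sup>2 * Z (Suc j) x - a\<^sup>2 * Z (Suc (Suc j)) x" for x
    by (simp add: g_def pair_def L_def)
  have hp: "h (pair x) = Z (Suc j) x + Z (Suc (Suc j)) x" for x
    by (simp add: h_def pair_def L_def)
  have zero: "expectation (\<lambda>x. g (pair x) * indicator A' (past_future x, h (pair x))) = 0"
    if A': "A' \<in> sets (PiM K (\<lambda>_. borel) \<Otimes>\<^sub>M borel)" for A'
  proof (rule indep_var_zero_on_generated[where S="PiM K (\<lambda>_. borel)" and P="PiM L (\<lambda>_. borel)"])
    show "indep_var (PiM K (\<lambda>_. borel)) past_future (PiM L (\<lambda>_. borel)) pair"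
      unfolding past_future_def pair_def by (rule indep_var_restrict[OF ind]) (use j in \<open>auto simp: K_def L_def\<close>)
    show "g \<in> borel_measurable (PiM L (\<lambda>_. borel))"
      unfolding g_def by (intro borel_measurable_diff borel_measurable_times borel_measurable_const measurable_component_singleton) (auto simp: L_def)
    show "h \<in> borel_measurable (PiM L (\<lambda>_. borel))"
      unfolding h_def by (intro borel_measurable_add measurable_component_singleton) (auto simp: L_def)
    have mU: "random_variable borel (Z (Suc j))" and mV: "random_variable borel (Z (Suc (Suc j)))"
      using indUV by (auto dest: indep_var_rv1 indep_var_rv2)
    show "integrable M (\<lambda>x. g (pair x))"
      unfolding gp
      by (intro Bochner_Integration.integrable_diff integrable_mult_right
          centred_normal_abs_moment(1)[OF mU distU] centred_normal_abs_moment(1)[OF mV distV])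
         (use ab0 \<sigma>_nonneg in auto)
    show "expectation (\<lambda>x. g (pair x) * indicator B (h (pair x))) = 0" if "B \<in> sets borel" for B
      unfolding gp hp by (rule normal_bridge[OF indUV \<sigma>_nonneg ab0 distU distV that])
  qed fact
  \<comment> \<open>recovers the observed values; index sets after the \<open>j\<close>-th date skip the pair next to \<open>s\<close>\<close>
  define \<Phi> where "\<Phi> = (\<lambda>z. \<lambda>i\<in>{0..n}. exp (- (\<theta> * r i)) *
     (if i \<le> j then \<Sum>l\<le>i. fst z l else (\<Sum>l\<in>{..Suc i} - L. fst z l) + snd z) :: real)"
  have comp: "(\<lambda>z. fst z l :: real) \<in> borel_measurable (PiM K (\<lambda>_. borel) \<Otimes>\<^sub>M (borel :: real measure))" if "l \<in> K" for l
    by (rule measurable_compose[OF measurable_fst measurable_component_singleton[OF that]])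
  have \<Phi>m: "\<Phi> \<in> measurable (PiM K (\<lambda>_. borel) \<Otimes>\<^sub>M borel) (PiM {0..n} (\<lambda>_. borel))"
    unfolding \<Phi>_def
  proof (rule measurable_restrict)
    fix i assume i: "i \<in> {0..n}"
    have 1: "(\<lambda>z. \<Sum>l\<le>i. fst z l :: real) \<in> borel_measurable (PiM K (\<lambda>_. borel) \<Otimes>\<^sub>M (borel :: real measure))" if "i \<le> j"
      by (intro borel_measurable_sum comp) (use that i j in \<open>auto simp: K_def L_def\<close>)
    have 2: "(\<lambda>z. (\<Sum>l\<in>{..Suc i} - L. fst z l) + snd z :: real) \<in> borel_measurable (PiM K (\<lambda>_. borel) \<Otimes>\<^sub>M (borel :: real measure))"
      by (intro borel_measurable_add borel_measurable_sum comp measurable_snd) (use i in \<open>auto simp: K_def\<close>)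
    show "(\<lambda>z. exp (- (\<theta> * r i)) * (if i \<le> j then \<Sum>l\<le>i. fst z l else (\<Sum>l\<in>{..Suc i} - L. fst z l) + snd z))
        \<in> borel_measurable (PiM K (\<lambda>_. borel) \<Otimes>\<^sub>M borel)"
      using 1 2 by (cases "i \<le> j") auto
  qed
  have \<Phi>_eq: "(\<lambda>i\<in>{0..n}. X (r i) x) = \<Phi> (past_future x, h (pair x))" for x
  proof
    fix i
    show "(\<lambda>i\<in>{0..n}. X (r i) x) i = \<Phi> (past_future x, h (pair x)) i"
    proof (cases "i \<le> n")
      case i: True
      have XY: "X (r i) x = exp (- (\<theta> * r i)) * Y (r i) x"
        by (simp add: Y_def mult.assoc[symmetric] mult_exp_exp)
      show ?thesis
      proof (cases "i \<le> j")
        case True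
        have "(\<Sum>l\<le>i. past_future x l) = (\<Sum>l\<le>i. Z l x)"
          by (intro sum.cong) (use True i in \<open>auto simp: past_future_def K_def L_def\<close>)
        also have "\<dots> = Y (r i) x" using True by (simp add: tel p_def)
        finally show ?thesis using True i XY by (simp add: \<Phi>_def)
      next
        case False
        have "(\<Sum>l\<in>{..Suc i} - L. past_future x l) = (\<Sum>l\<in>{..Suc i} - L. Z l x)"
          by (intro sum.cong) (use i in \<open>auto simp: past_future_def K_def\<close>)
        moreover have "h (pair x) = (\<Sum>l\<in>L. Z l x)" by (simp add: hp L_def)
        moreover have "(\<Sum>l\<in>{..Suc i} - L. Z l x) + (\<Sum>l\<in>L. Z l x) = (\<Sum>l\<le>Suc i. Z l x)"
          by (rule sum.subset_diff[symmetric]) (use False in \<open>auto simp: L_def\<close>)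
        moreover have "(\<Sum>l\<le>Suc i. Z l x) = Y (r i) x"
          unfolding tel using False by (simp add: p_def)
        ultimately have "(\<Sum>l\<in>{..Suc i} - L. past_future x l) + h (pair x) = Y (r i) x" by simp
        then show ?thesis using False i XY by (simp add: \<Phi>_def)
      qed
    qed (simp add: \<Phi>_def)
  qed
  have "(\<lambda>x. \<lambda>i\<in>{0..n}. X (r i) x) \<in> space M \<rightarrow> space (PiM {0..n} (\<lambda>_. borel))"
    by (auto simp: space_PiM)
  from sets_vimage_algebra2[OF this] A obtain B where
    B: "B \<in> sets (PiM {0..n} (\<lambda>_. borel))" and AB: "A = (\<lambda>x. \<lambda>i\<in>{0..n}. X (r i) x) -` B \<inter> space M"
    unfolding sigma_of_dates_def by auto
  define A' where "A' = \<Phi> -` B \<inter> space (PiM K (\<lambda>_. borel) \<Otimes>\<^sub>M (borel :: real measure))"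
  have A': "A' \<in> sets (PiM K (\<lambda>_. borel) \<Otimes>\<^sub>M borel)"
    unfolding A'_def by (rule measurable_sets[OF \<Phi>m B])
  have ind_eq: "indicator A x = (indicator A' (past_future x, h (pair x)) :: real)" if "x \<in> space M" for x
  proof -
    have "(past_future x, h (pair x)) \<in> space (PiM K (\<lambda>_. borel) \<Otimes>\<^sub>M (borel :: real measure))"
      by (auto simp: space_pair_measure space_PiM past_future_def)
    then show ?thesis using that by (auto simp: AB A'_def \<Phi>_eq indicator_def)
  qed
  let ?\<kappa> = "exp (- (\<theta> * s)) / (clock ?v - clock ?u)"
  have "expectation (\<lambda>x. (X s x - (bridge_weight (?v - s) ?u ?v * X ?u x + bridge_weight (s - ?u) ?u ?v * X ?v x)) * indicator A x) =
      expectation (\<lambda>x. ?\<kappa> * (g (pair x) * indicator A' (past_future x, h (pair x))))"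
  proof (rule Bochner_Integration.integral_cong[OF refl])
    fix x assume "x \<in> space M"
    from ind_eq[OF this]
    show "(X s x - (bridge_weight (?v - s) ?u ?v * X ?u x + bridge_weight (s - ?u) ?u ?v * X ?v x)) * indicator A x =
       ?\<kappa> * (g (pair x) * indicator A' (past_future x, h (pair x)))"
      unfolding bridge_residual[OF j(2)] gp ZU ZV a2 b2 by simp
  qed
  also have "\<dots> = 0" using zero[OF A'] by simp
  finally show ?thesis .
qed

end

section \<open>The coefficients as integrals of the bridge weights, and their limits\<close>

text \<open>Antiderivatives exist in closed form because \<open>e'' = - \<omega>\<^sup>2 e\<close> while the weight \<open>w\<close> satisfies
  \<open>w'' = \<theta>\<^sup>2 w\<close>: the Wronskian \<open>w' e - w e'\<close> has derivative \<open>(\<theta>\<^sup>2 + \<omega>\<^sup>2) w e\<close>. This is where the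
  formulas for the coefficients come from.\<close>

lemma sinh_weight_integral:
  fixes e e' :: "real \<Rightarrow> real"
  assumes "\<theta> > 0" "u < v"
    and e: "\<And>s. (e has_real_derivative e' s) (at s)"
    and e': "\<And>s. (e' has_real_derivative - (\<omega>\<^sup>2 * e s)) (at s)"
  shows "((\<lambda>s. sinh (\<theta> * (v - s)) / sinh (\<theta> * (v - u)) * e s) has_integral coeff_A \<theta> \<omega> e u v) {u..v}"
    and "((\<lambda>s. sinh (\<theta> * (s - u)) / sinh (\<theta> * (v - u)) * e s) has_integral coeff_B \<theta> \<omega> e u v) {u..v}"
proof -
  define S C where "S = sinh (\<theta> * (v - u))" and "C = cosh (\<theta> * (v - u))"
  define D where "D = \<theta>\<^sup>2 + \<omega>\<^sup>2"
  have S: "S \<noteq> 0" using assms by (simp add: S_def)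
  have D: "D \<noteq> 0" using assms(1) by (simp add: D_def add_pos_nonneg less_imp_neq[symmetric])
  have de: "deriv e s = e' s" for s using e by (rule DERIV_imp_deriv)
  have ex: "exp (\<theta> * (v - u)) - exp (- \<theta> * (v - u)) = 2 * S" "exp (\<theta> * (v - u)) + exp (- \<theta> * (v - u)) = 2 * C"
    by (simp_all add: S_def C_def sinh_field_def cosh_field_def)
  have A: "coeff_A \<theta> \<omega> e u v = - \<theta> / D * (e v / S - e u * (C / S)) + 1 / D * e' u"
    unfolding coeff_A_def Let_def de ex D_def[symmetric] by simp
  have B: "coeff_B \<theta> \<omega> e u v = \<theta> / D * (e v * (C / S) - e u / S) - 1 / D * e' v"
    unfolding coeff_B_def Let_def de ex D_def[symmetric] by simp
  define F where "F s = - (\<theta> * cosh (\<theta> * (v - s)) * e s + sinh (\<theta> * (v - s)) * e' s) / (D * S)" for s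
  have "((\<lambda>s. sinh (\<theta> * (v - s)) / S * e s) has_integral F v - F u) {u..v}"
  proof (rule fundamental_theorem_of_calculus)
    fix s
    have "(F has_real_derivative (sinh (\<theta> * (v - s)) / S * e s)) (at s)"
      unfolding F_def
      apply (rule derivative_eq_intros e e' refl | simp add: S D)+
      using S D by (simp add: field_simps) (simp add: D_def algebra_simps power2_eq_square)
    then show "(F has_vector_derivative sinh (\<theta> * (v - s)) / S * e s) (at s within {u..v})"
      by (simp add: has_real_derivative_iff_has_vector_derivative has_vector_derivative_at_within)
  qed (use assms in simp)
  also have "F v - F u = coeff_A \<theta> \<omega> e u v"
  proof -
    have Fv: "F v = - (\<theta> * e v) / (D * S)" and Fu: "F u = - (\<theta> * C * e u + S * e' u) / (D * S)"
      by (simp_all add: F_def S_def C_def)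
    show ?thesis unfolding A Fv Fu using S D by (simp add: field_simps)
  qed
  finally show "((\<lambda>s. sinh (\<theta> * (v - s)) / sinh (\<theta> * (v - u)) * e s) has_integral coeff_A \<theta> \<omega> e u v) {u..v}"
    by (simp add: S_def)
  define G where "G s = (\<theta> * cosh (\<theta> * (s - u)) * e s - sinh (\<theta> * (s - u)) * e' s) / (D * S)" for s
  have "((\<lambda>s. sinh (\<theta> * (s - u)) / S * e s) has_integral G v - G u) {u..v}"
  proof (rule fundamental_theorem_of_calculus)
    fix s
    have "(G has_real_derivative (sinh (\<theta> * (s - u)) / S * e s)) (at s)"
      unfolding G_def
      apply (rule derivative_eq_intros e e' refl | simp add: S D)+
      using S D by (simp add: field_simps) (simp add: D_def algebra_simps power2_eq_square)
    then show "(G has_vector_derivative sinh (\<theta> * (s - u)) / S * e s) (at s within {u..v})"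
      by (simp add: has_real_derivative_iff_has_vector_derivative has_vector_derivative_at_within)
  qed (use assms in simp)
  also have "G v - G u = coeff_B \<theta> \<omega> e u v"
  proof -
    have Gv: "G v = (\<theta> * C * e v - S * e' v) / (D * S)" and Gu: "G u = (\<theta> * e u) / (D * S)"
      by (simp_all add: G_def S_def C_def)
    show ?thesis unfolding B Gv Gu using S D by (simp add: field_simps)
  qed
  finally show "((\<lambda>s. sinh (\<theta> * (s - u)) / sinh (\<theta> * (v - u)) * e s) has_integral coeff_B \<theta> \<omega> e u v) {u..v}"
    by (simp add: S_def)
qed

lemma has_derivative_quotient_limit:
  fixes f g :: "real \<Rightarrow> real"
  assumes "(f has_real_derivative f') (at a)" "(g has_real_derivative g') (at a)" "f a = 0" "g a = 0" "g' \<noteq> 0"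
  shows "((\<lambda>x. f x / g x) \<longlongrightarrow> f' / g') (at a)"
proof -
  have "((\<lambda>x. (f x - f a) / (x - a)) \<longlongrightarrow> f') (at a)" "((\<lambda>x. (g x - g a) / (x - a)) \<longlongrightarrow> g') (at a)"
    using assms(1,2) by (auto simp: has_field_derivative_iff)
  from tendsto_divide[OF this assms(5)] have "((\<lambda>x. ((f x - f a) / (x - a)) / ((g x - g a) / (x - a))) \<longlongrightarrow> f' / g') (at a)" .
  moreover have "\<forall>\<^sub>F x in at a. ((f x - f a) / (x - a)) / ((g x - g a) / (x - a)) = f x / g x"
    using eventually_neq_at_within[of a] by eventually_elim (simp add: assms(3,4))
  ultimately show ?thesis by (rule Lim_transform_eventually)
qed

text \<open>The bracket is a quotient of two functions of \<open>v\<close> vanishing at \<open>u\<close>; the quotient of their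
  derivatives cancels the term with the derivative of \<open>e\<close>.\<close>

lemma coeff_A_limit:
  fixes e e' :: "real \<Rightarrow> real"
  assumes "\<theta> > 0" and e: "\<And>s. (e has_real_derivative e' s) (at s)"
  shows "((\<lambda>v. coeff_A \<theta> \<omega> e u v) \<longlongrightarrow> 0) (at u)"
proof -
  define f g where "f v = 2 * e v - e u * (exp (\<theta> * (v - u)) + exp (- \<theta> * (v - u)))"
    and "g v = exp (\<theta> * (v - u)) - exp (- \<theta> * (v - u))" for v
  have "((\<lambda>v. f v / g v) \<longlongrightarrow> (2 * e' u) / (2 * \<theta>)) (at u)"
  proof (rule has_derivative_quotient_limit)
    show "(f has_real_derivative 2 * e' u) (at u)"
      unfolding f_def by (rule derivative_eq_intros e refl | simp)+
    show "(g has_real_derivative 2 * \<theta>) (at u)"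
      unfolding g_def by (rule derivative_eq_intros refl | simp)+
  qed (use assms in \<open>simp_all add: f_def g_def\<close>)
  then have "((\<lambda>v. - \<theta> / (\<theta>\<^sup>2 + \<omega>\<^sup>2) * (f v / g v) + 1 / (\<theta>\<^sup>2 + \<omega>\<^sup>2) * e' u) \<longlongrightarrow>
     - \<theta> / (\<theta>\<^sup>2 + \<omega>\<^sup>2) * ((2 * e' u) / (2 * \<theta>)) + 1 / (\<theta>\<^sup>2 + \<omega>\<^sup>2) * e' u) (at u)"
    by (rule tendsto_add[OF tendsto_mult[OF tendsto_const] tendsto_const])
  moreover have "- \<theta> / (\<theta>\<^sup>2 + \<omega>\<^sup>2) * ((2 * e' u) / (2 * \<theta>)) + 1 / (\<theta>\<^sup>2 + \<omega>\<^sup>2) * e' u = 0"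
    using assms(1) by simp
  moreover have "(\<lambda>v. - \<theta> / (\<theta>\<^sup>2 + \<omega>\<^sup>2) * (f v / g v) + 1 / (\<theta>\<^sup>2 + \<omega>\<^sup>2) * e' u) = (\<lambda>v. coeff_A \<theta> \<omega> e u v)"
    unfolding coeff_A_def Let_def f_def g_def DERIV_imp_deriv[OF e] by (simp add: diff_divide_distrib)
  ultimately show ?thesis by simp
qed

lemma coeff_B_limit:
  fixes e e' :: "real \<Rightarrow> real"
  assumes "\<theta> > 0" and e: "\<And>s. (e has_real_derivative e' s) (at s)"
  shows "((\<lambda>u. coeff_B \<theta> \<omega> e u v) \<longlongrightarrow> 0) (at v)"
proof -
  define f g where "f u = e v * (exp (\<theta> * (v - u)) + exp (- \<theta> * (v - u))) - 2 * e u"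
    and "g u = exp (\<theta> * (v - u)) - exp (- \<theta> * (v - u))" for u
  have "((\<lambda>u. f u / g u) \<longlongrightarrow> (- 2 * e' v) / (- 2 * \<theta>)) (at v)"
  proof (rule has_derivative_quotient_limit)
    show "(f has_real_derivative - 2 * e' v) (at v)"
      unfolding f_def by (rule derivative_eq_intros e refl | simp)+
    show "(g has_real_derivative - 2 * \<theta>) (at v)"
      unfolding g_def by (rule derivative_eq_intros refl | simp)+
  qed (use assms in \<open>simp_all add: f_def g_def\<close>)
  then have "((\<lambda>u. \<theta> / (\<theta>\<^sup>2 + \<omega>\<^sup>2) * (f u / g u) - 1 / (\<theta>\<^sup>2 + \<omega>\<^sup>2) * e' v) \<longlongrightarrow>
     \<theta> / (\<theta>\<^sup>2 + \<omega>\<^sup>2) * ((- 2 * e' v) / (- 2 * \<theta>)) - 1 / (\<theta>\<^sup>2 + \<omega>\<^sup>2) * e' v) (at v)"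
    by (rule tendsto_diff[OF tendsto_mult[OF tendsto_const] tendsto_const])
  moreover have "\<theta> / (\<theta>\<^sup>2 + \<omega>\<^sup>2) * ((- 2 * e' v) / (- 2 * \<theta>)) - 1 / (\<theta>\<^sup>2 + \<omega>\<^sup>2) * e' v = 0"
    using assms(1) by simp
  moreover have "(\<lambda>u. \<theta> / (\<theta>\<^sup>2 + \<omega>\<^sup>2) * (f u / g u) - 1 / (\<theta>\<^sup>2 + \<omega>\<^sup>2) * e' v) = (\<lambda>u. coeff_B \<theta> \<omega> e u v)"
    unfolding coeff_B_def Let_def f_def g_def DERIV_imp_deriv[OF e] by (simp add: diff_divide_distrib)
  ultimately show ?thesis by simp
qed

lemma sum_assemble_coeff:
  fixes y :: "nat \<Rightarrow> real"
  assumes "n \<ge> 1"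
  shows "(\<Sum>j=0..n. assemble_coeff A B n t j * y j) =
    (\<Sum>j<n. A (t j) (t (Suc j)) * y j + B (t j) (t (Suc j)) * y (Suc j))"
proof -
  have "(\<Sum>j=0..n. assemble_coeff A B n t j * y j) =
     (\<Sum>j\<le>n. (if j < n then A (t j) (t (Suc j)) * y j else 0) + (if 0 < j then B (t (j - 1)) (t j) * y j else 0))"
    using assms by (intro sum.cong) (auto simp: assemble_coeff_def algebra_simps)
  also have "\<dots> = (\<Sum>j\<le>n. if j < n then A (t j) (t (Suc j)) * y j else 0) + (\<Sum>j\<le>n. if 0 < j then B (t (j - 1)) (t j) * y j else 0)"
    by (rule sum.distrib)
  also have "(\<Sum>j\<le>n. if j < n then A (t j) (t (Suc j)) * y j else 0) = (\<Sum>j<n. A (t j) (t (Suc j)) * y j)"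
    by (simp add: lessThan_Suc_atMost[symmetric])
  also have "(\<Sum>j\<le>n. if 0 < j then B (t (j - 1)) (t j) * y j else 0) = (\<Sum>j<n. B (t j) (t (Suc j)) * y (Suc j))"
    unfolding lessThan_Suc_atMost[symmetric] by (subst sum.lessThan_Suc_shift) simp
  finally show ?thesis by (simp add: sum.distrib)
qed

lemma eigfun_trigonometric:
  obtains p q where "eigfun \<theta> \<sigma> \<sigma>0 T \<omega> = (\<lambda>s. p * cos (\<omega> * s) + q * sin (\<omega> * s))"
proof (cases "\<sigma>0 = 0")
  case True
  then show ?thesis
    by (intro that[of 0 "(T / 2 - sin (2 * \<omega> * T) / (4 * \<omega>)) powr (- 1 / 2)"])
       (simp add: eigfun_def eigfun_a_def fun_eq_iff)
next
  case False
  then show ?thesis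
    by (intro that[of "norm_const_b \<theta> \<sigma> \<sigma>0 T \<omega> * (\<omega> * \<sigma>0\<^sup>2)" "norm_const_b \<theta> \<sigma> \<sigma>0 T \<omega> * (\<sigma>\<^sup>2 - \<theta> * \<sigma>0\<^sup>2)"])
       (simp add: eigfun_def eigfun_b_def eigfun_b_raw_def fun_eq_iff algebra_simps)
qed

lemma trigonometric_derivs:
  fixes p q \<omega> :: real
  shows "((\<lambda>s. p * cos (\<omega> * s) + q * sin (\<omega> * s)) has_real_derivative \<omega> * (q * cos (\<omega> * s) - p * sin (\<omega> * s))) (at s)"
    and "((\<lambda>s. \<omega> * (q * cos (\<omega> * s) - p * sin (\<omega> * s))) has_real_derivative - (\<omega>\<^sup>2 * (p * cos (\<omega> * s) + q * sin (\<omega> * s)))) (at s)"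
  by (rule derivative_eq_intros refl | simp add: power2_eq_square algebra_simps)+

lemma trigonometric_square_integral:
  fixes p q \<omega> T :: real
  assumes "\<omega> > 0" "T > 0"
  shows "(LBINT s:{0..T}. (p * cos (\<omega> * s) + q * sin (\<omega> * s))\<^sup>2) =
    p * q * (1 - cos (2 * \<omega> * T)) / (2 * \<omega>) + p\<^sup>2 / 2 * (T + sin (2 * \<omega> * T) / (2 * \<omega>)) + q\<^sup>2 / 2 * (T - sin (2 * \<omega> * T) / (2 * \<omega>))"
proof -
  define F where "F s = p * q * (1 - cos (2 * \<omega> * s)) / (2 * \<omega>) + p\<^sup>2 / 2 * (s + sin (2 * \<omega> * s) / (2 * \<omega>)) + q\<^sup>2 / 2 * (s - sin (2 * \<omega> * s) / (2 * \<omega>))" for s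
  have dbl: "cos (2 * \<omega> * s) = 2 * (cos (\<omega> * s))\<^sup>2 - 1" "cos (2 * \<omega> * s) = 1 - 2 * (sin (\<omega> * s))\<^sup>2"
    "sin (2 * \<omega> * s) = 2 * sin (\<omega> * s) * cos (\<omega> * s)" for s
    using cos_double_cos[of "\<omega> * s"] cos_double_sin[of "\<omega> * s"] sin_double[of "\<omega> * s"] by (simp_all add: mult.assoc)
  have "((\<lambda>s. (p * cos (\<omega> * s) + q * sin (\<omega> * s))\<^sup>2) has_integral F T - F 0) {0..T}"
  proof (rule fundamental_theorem_of_calculus)
    fix s
    have "(F has_real_derivative p * q * sin (2 * \<omega> * s) + p\<^sup>2 / 2 * (1 + cos (2 * \<omega> * s)) + q\<^sup>2 / 2 * (1 - cos (2 * \<omega> * s))) (at s)"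
      unfolding F_def using assms by (auto intro!: derivative_eq_intros simp: field_simps)
    also have "p * q * sin (2 * \<omega> * s) + p\<^sup>2 / 2 * (1 + cos (2 * \<omega> * s)) + q\<^sup>2 / 2 * (1 - cos (2 * \<omega> * s)) = (p * cos (\<omega> * s) + q * sin (\<omega> * s))\<^sup>2"
    proof -
      have m1: "p\<^sup>2 / 2 * (1 + cos (2 * \<omega> * s)) = p\<^sup>2 * (cos (\<omega> * s))\<^sup>2" unfolding dbl(1) by simp
      have m2: "q\<^sup>2 / 2 * (1 - cos (2 * \<omega> * s)) = q\<^sup>2 * (sin (\<omega> * s))\<^sup>2" unfolding dbl(2) by simp
      show ?thesis unfolding m1 m2 dbl(3) by (simp add: power2_eq_square algebra_simps)
    qed
    finally show "(F has_vector_derivative (p * cos (\<omega> * s) + q * sin (\<omega> * s))\<^sup>2) (at s within {0..T})"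
      by (simp add: has_real_derivative_iff_has_vector_derivative has_vector_derivative_at_within)
  qed (use assms in simp)
  moreover have "(LBINT s:{0..T}. (p * cos (\<omega> * s) + q * sin (\<omega> * s))\<^sup>2) = integral {0..T} (\<lambda>s. (p * cos (\<omega> * s) + q * sin (\<omega> * s))\<^sup>2)"
    by (intro set_borel_integral_eq_integral borel_integrable_atLeastAtMost' continuous_intros)
  ultimately have "(LBINT s:{0..T}. (p * cos (\<omega> * s) + q * sin (\<omega> * s))\<^sup>2) = F T - F 0"
    by (simp add: integral_unique)
  then show ?thesis by (simp add: F_def)
qed

lemma trigonometric_square_integral_pos:
  fixes p q \<omega> T :: real
  assumes "T > 0" "p \<noteq> 0"
  shows "(LBINT s:{0..T}. (p * cos (\<omega> * s) + q * sin (\<omega> * s))\<^sup>2) > 0"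
proof -
  let ?f = "\<lambda>s. (p * cos (\<omega> * s) + q * sin (\<omega> * s))\<^sup>2"
  have cont: "continuous_on {0..T} ?f" by (intro continuous_intros)
  have eq: "(LBINT s:{0..T}. ?f s) = integral {0..T} ?f"
    by (intro set_borel_integral_eq_integral borel_integrable_atLeastAtMost' cont)
  have nn: "integral {0..T} ?f \<ge> 0" by (intro Henstock_Kurzweil_Integration.integral_nonneg integrable_continuous_real cont) auto
  have "integral {0..T} ?f \<noteq> 0"
  proof
    assume "integral {0..T} ?f = 0"
    then have "\<forall>s\<in>{0..T}. ?f s = 0"
      using integral_eq_0_iff[OF cont] assms by auto
    then have "?f 0 = 0" by (rule bspec) (use assms in simp)
    then show False using assms by simp
  qed
  then show ?thesis using eq nn by simp
qed

section \<open>Integration over time and the conditional expectation\<close>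

lemma set_integral_schedule:
  fixes f :: "real \<Rightarrow> real"
  assumes cont: "continuous_on {0..T} f" and r0: "r 0 = 0" and rT: "\<And>k. k \<le> n \<Longrightarrow> r k \<le> T"
    and mono: "\<And>k. k < n \<Longrightarrow> r k \<le> r (Suc k)"
  shows "(LBINT s:{0..r n}. f s) = (\<Sum>j<n. LBINT s:{r j..r (Suc j)}. f s)"
proof -
  have eq: "(LBINT s:{a..b}. f s) = integral {a..b} f" if "0 \<le> a" "b \<le> T" for a b
    by (intro set_borel_integral_eq_integral borel_integrable_atLeastAtMost' continuous_on_subset[OF cont])
       (use that in auto)
  have "0 \<le> r k \<and> (LBINT s:{0..r k}. f s) = (\<Sum>j<k. LBINT s:{r j..r (Suc j)}. f s)" if "k \<le> n" for k
    using that
  proof (induct k)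
    case 0
    then show ?case using r0 eq[of 0 0] rT[of 0] by simp
  next
    case (Suc k)
    then have IH: "0 \<le> r k" "(LBINT s:{0..r k}. f s) = (\<Sum>j<k. LBINT s:{r j..r (Suc j)}. f s)" and m: "r k \<le> r (Suc k)"
      using mono[of k] by auto
    have "integral {0..r k} f + integral {r k..r (Suc k)} f = integral {0..r (Suc k)} f"
      using IH m rT[of "Suc k"] Suc(2)
      by (intro Henstock_Kurzweil_Integration.integral_combine integrable_continuous_real continuous_on_subset[OF cont]) auto
    then have "(LBINT s:{0..r (Suc k)}. f s) = (LBINT s:{0..r k}. f s) + (LBINT s:{r k..r (Suc k)}. f s)"
      using eq[of 0 "r k"] eq[of "r k" "r (Suc k)"] eq[of 0 "r (Suc k)"] IH(1) m rT[of "Suc k"] Suc(2) by simp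
    then show ?case using IH m by simp
  qed
  then show ?thesis by blast
qed

lemma floor_fraction_tendsto: "(\<lambda>i. real_of_int \<lfloor>real (Suc i) * s\<rfloor> / real (Suc i)) \<longlonglongrightarrow> s"
proof -
  have "\<bar>real_of_int \<lfloor>real (Suc i) * s\<rfloor> / real (Suc i) - s\<bar> \<le> inverse (real (Suc i))" for i
  proof -
    have "\<bar>real_of_int \<lfloor>real (Suc i) * s\<rfloor> - real (Suc i) * s\<bar> \<le> 1" by linarith
    moreover have "real_of_int \<lfloor>real (Suc i) * s\<rfloor> / real (Suc i) - s = (real_of_int \<lfloor>real (Suc i) * s\<rfloor> - real (Suc i) * s) / real (Suc i)"
      by (simp add: diff_divide_distrib)
    ultimately show ?thesis by (simp add: divide_right_mono inverse_eq_divide abs_divide del: of_nat_Suc)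
  qed
  then have "(\<lambda>i. real_of_int \<lfloor>real (Suc i) * s\<rfloor> / real (Suc i) - s) \<longlonglongrightarrow> 0"
    by (intro Lim_null_comparison[OF _ LIMSEQ_inverse_real_of_nat]) auto
  then show ?thesis by (rule LIM_zero_cancel)
qed

context ornstein_uhlenbeck
begin

text \<open>Extends the paths continuously to all times, so that joint measurability can be stated on the
  whole line.\<close>

definition clamp :: "real \<Rightarrow> real" where
  "clamp s = max 0 (min T s)"

lemma clamp_in: "clamp s \<in> {0..T}"
  using T_pos by (simp add: clamp_def)

lemma clamp_id: "s \<in> {0..T} \<Longrightarrow> clamp s = s"
  by (simp add: clamp_def)

text \<open>A process with continuous paths is the limit of its discretizations in time, each of which is
  a countable combination of the variables at fixed times.\<close>

lemma X_jointly_measurable: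
  "(\<lambda>z. X (clamp (fst z)) (snd z)) \<in> borel_measurable (lborel \<Otimes>\<^sub>M M)"
proof (rule borel_measurable_LIMSEQ_real)
  fix z :: "real \<times> 'w" assume "z \<in> space (lborel \<Otimes>\<^sub>M M)"
  then have z: "snd z \<in> space M" by (auto simp: space_pair_measure)
  have "(\<lambda>i. clamp (real_of_int \<lfloor>real (Suc i) * fst z\<rfloor> / real (Suc i))) \<longlonglongrightarrow> clamp (fst z)"
    unfolding clamp_def by (intro tendsto_max tendsto_min tendsto_const floor_fraction_tendsto)
  from continuous_on_tendsto_compose[OF X_continuous[OF z] this clamp_in]
  show "(\<lambda>i. X (clamp (real_of_int \<lfloor>real (Suc i) * fst z\<rfloor> / real (Suc i))) (snd z)) \<longlonglongrightarrow> X (clamp (fst z)) (snd z)"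
    using clamp_in by simp
next
  fix i
  show "(\<lambda>z. X (clamp (real_of_int \<lfloor>real (Suc i) * fst z\<rfloor> / real (Suc i))) (snd z)) \<in> borel_measurable (lborel \<Otimes>\<^sub>M M)"
  proof (rule measurable_compose_countable[where f="\<lambda>k z. X (clamp (real_of_int k / real (Suc i))) (snd z)"])
    fix k :: int
    show "(\<lambda>z. X (clamp (real_of_int k / real (Suc i))) (snd z)) \<in> borel_measurable (lborel \<Otimes>\<^sub>M M)"
      by (rule measurable_compose[OF measurable_snd X_measurable[OF clamp_in]])
    show "(\<lambda>z. \<lfloor>real (Suc i) * fst z\<rfloor>) \<in> measurable (lborel \<Otimes>\<^sub>M M) (count_space UNIV)"
      by measurable
  qed
qed

text \<open>Fubini's theorem applies since the first absolute moment of the process is bounded on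
  \<open>[0, T]\<close>. It reduces statements about the path integral to statements at a fixed time.\<close>

lemma weighted_path_integral:
  assumes uv: "0 \<le> u" "v \<le> T" and e: "continuous_on UNIV e"
  shows "integrable M (\<lambda>x. LBINT s:{u..v}. X s x * e s)"
    and "A \<in> events \<Longrightarrow> expectation (\<lambda>x. (LBINT s:{u..v}. X s x * e s) * indicator A x) =
      (LBINT s:{u..v}. expectation (\<lambda>x. X s x * indicator A x) * e s)"
proof -
  interpret P: pair_sigma_finite lborel M ..
  have em[measurable]: "e \<in> borel_measurable borel" by (rule borel_measurable_continuous_onI[OF e])
  note X_jointly_measurable[measurable]
  define f where "f s x = indicator {u..v} s * (X (clamp s) x * e s)" for s x
  have clamp_uv: "clamp s = s" "s \<in> {0..T}" if "s \<in> {u..v}" for s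
    using that uv clamp_id by auto
  have fm[measurable]: "(\<lambda>z. f (fst z) (snd z)) \<in> borel_measurable (lborel \<Otimes>\<^sub>M M)"
    unfolding f_def by measurable
  have "bounded (e ` {u..v})"
    by (rule compact_imp_bounded[OF compact_continuous_image[OF continuous_on_subset[OF e] compact_Icc]]) simp
  then obtain K where "\<forall>y\<in>e ` {u..v}. norm y \<le> K" unfolding bounded_iff by blast
  then have K: "\<bar>e s\<bar> \<le> K" if "s \<in> {u..v}" for s using that by simp
  define C where "C = 2 + \<sigma>0\<^sup>2 + \<sigma>\<^sup>2 * clock T"
  have if': "integrable M (f s)" for s
    unfolding f_def using X_abs_moment(1)[OF clamp_in] by (intro integrable_mult_right integrable_mult_left) auto
  have nrm: "(\<integral>x. norm (f s x) \<partial>M) \<le> indicator {u..v} s * (C * K)" for s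
  proof (cases "s \<in> {u..v}")
    case True
    have "(\<integral>x. norm (f s x) \<partial>M) = expectation (\<lambda>x. \<bar>X s x\<bar>) * \<bar>e s\<bar>"
      using clamp_uv[OF True] True by (simp add: f_def abs_mult)
    also have "\<dots> \<le> C * K"
    proof -
      have "expectation (\<lambda>x. \<bar>X s x\<bar>) \<le> C" "0 \<le> expectation (\<lambda>x. \<bar>X s x\<bar>)"
        using X_abs_moment(2)[OF clamp_uv(2)[OF True]] by (simp_all add: C_def)
      moreover from this have "0 \<le> C" by linarith
      ultimately show ?thesis using K[OF True] by (intro mult_mono) auto
    qed
    finally show ?thesis using True by simp
  qed (simp add: f_def)
  have int: "integrable (lborel \<Otimes>\<^sub>M M) (\<lambda>z. f (fst z) (snd z))"
  proof (rule P.Fubini_integrable)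
    have "integrable lborel (\<lambda>s. \<integral>x. norm (f s x) \<partial>M)"
    proof (rule Bochner_Integration.integrable_bound)
      show "integrable lborel (\<lambda>s. indicator {u..v} s * (C * K))"
        by (intro integrable_mult_left integrable_real_indicator) (auto simp: emeasure_lborel_Icc_eq)
      show "(\<lambda>s. \<integral>x. norm (f s x) \<partial>M) \<in> borel_measurable lborel"
      proof (rule borel_measurable_lebesgue_integral)
        show "(\<lambda>(s, x). norm (f s x)) \<in> borel_measurable (lborel \<Otimes>\<^sub>M M)"
          using fm by (simp add: case_prod_beta')
      qed
      show "AE s in lborel. norm (\<integral>x. norm (f s x) \<partial>M) \<le> norm (indicator {u..v} s * (C * K))"
      proof (rule AE_I2)
        fix s
        have "0 \<le> (\<integral>x. norm (f s x) \<partial>M)" by simp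
        then show "norm (\<integral>x. norm (f s x) \<partial>M) \<le> norm (indicator {u..v} s * (C * K))"
          using nrm[of s] by (simp only: real_norm_def)
      qed
    qed
    then show "integrable lborel (\<lambda>s. \<integral>x. norm (f (fst (s, x)) (snd (s, x))) \<partial>M)" by simp
    show "AE s in lborel. integrable M (\<lambda>x. f (fst (s, x)) (snd (s, x)))" using if' by simp
  qed (rule fm)
  have slice: "(\<integral>s. f s x \<partial>lborel) = (LBINT s:{u..v}. X s x * e s)" for x
    unfolding set_lebesgue_integral_def f_def
    by (rule Bochner_Integration.integral_cong[OF refl]) (auto simp: indicator_def clamp_uv)
  show "integrable M (\<lambda>x. LBINT s:{u..v}. X s x * e s)"
    using P.integrable_snd[of f] int unfolding slice by (simp add: case_prod_beta')
  assume A[measurable]: "A \<in> events"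
  have intA: "integrable (lborel \<Otimes>\<^sub>M M) (\<lambda>z. f (fst z) (snd z) * indicator A (snd z))"
    by (rule Bochner_Integration.integrable_bound[OF int]) (auto simp: indicator_def intro!: AE_I2)
  have "expectation (\<lambda>x. (LBINT s:{u..v}. X s x * e s) * indicator A x) = expectation (\<lambda>x. \<integral>s. f s x * indicator A x \<partial>lborel)"
    unfolding slice[symmetric] by simp
  also have "\<dots> = (\<integral>s. expectation (\<lambda>x. f s x * indicator A x) \<partial>lborel)"
    using P.Fubini_integral[of "\<lambda>s x. f s x * indicator A x"] intA by (simp add: case_prod_beta')
  also have "\<dots> = (LBINT s:{u..v}. expectation (\<lambda>x. X s x * indicator A x) * e s)"
    unfolding set_lebesgue_integral_def
  proof (rule Bochner_Integration.integral_cong[OF refl])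
    fix s
    show "expectation (\<lambda>x. f s x * indicator A x) = indicat_real {u..v} s *\<^sub>R (expectation (\<lambda>x. X s x * indicator A x) * e s)"
    proof (cases "s \<in> {u..v}")
      case True
      then have "expectation (\<lambda>x. f s x * indicator A x) = expectation (\<lambda>x. (X s x * indicator A x) * e s)"
        using clamp_uv[OF True] by (simp add: f_def mult_ac)
      then show ?thesis using True by simp
    qed (simp add: f_def)
  qed
  finally show "expectation (\<lambda>x. (LBINT s:{u..v}. X s x * e s) * indicator A x) =
      (LBINT s:{u..v}. expectation (\<lambda>x. X s x * indicator A x) * e s)" .
qed

lemma integrable_X_indicator:
  "s \<in> {0..T} \<Longrightarrow> A \<in> events \<Longrightarrow> integrable M (\<lambda>x. X s x * indicator A x)"
  using X_abs_moment(1) by (intro integrable_real_mult_indicator) auto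

context
  fixes n :: nat and r :: "nat \<Rightarrow> real" and \<omega> :: real and e e' :: "real \<Rightarrow> real"
  assumes r0: "r 0 = 0" and rn: "r n = T" and mono: "\<And>k. k < n \<Longrightarrow> r k \<le> r (Suc k)"
    and e: "\<And>s. (e has_real_derivative e' s) (at s)"
    and e': "\<And>s. (e' has_real_derivative - (\<omega>\<^sup>2 * e s)) (at s)"
begin

lemma schedule_in_range: "k \<le> n \<Longrightarrow> r k \<in> {0..T}"
proof -
  assume k: "k \<le> n"
  have rle: "r k \<le> r l" if "k \<le> l" "l \<le> n" for k l
    using that(1) that(2) by (induct rule: dec_induct) (use mono in \<open>auto intro: order.trans\<close>)
  show "r k \<in> {0..T}" using rle[of 0 k] rle[of k n] k r0 rn by auto
qed

lemma e_continuous: "continuous_on S e"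
  using e by (meson DERIV_isCont continuous_at_imp_continuous_on)

text \<open>Tested against an event of the observed sigma-algebra, the process at a time inside an
  interval may be replaced by its interpolation, and the weights then integrate to the two
  coefficients.\<close>

lemma interval_regression:
  assumes j: "j < n" and A: "A \<in> sets (sigma_of_dates M X n r)"
  shows "expectation (\<lambda>x. (LBINT s:{r j..r (Suc j)}. X s x * e s) * indicator A x) =
    (if r j = r (Suc j) then 0 else coeff_A \<theta> \<omega> e (r j) (r (Suc j))) * expectation (\<lambda>x. X (r j) x * indicator A x) +
    (if r j = r (Suc j) then 0 else coeff_B \<theta> \<omega> e (r j) (r (Suc j))) * expectation (\<lambda>x. X (r (Suc j)) x * indicator A x)"
proof -
  let ?u = "r j" and ?v = "r (Suc j)"
  have uv: "0 \<le> ?u" "?u \<le> T" "0 \<le> ?v" "?v \<le> T" using schedule_in_range[of j] schedule_in_range[of "Suc j"] j by auto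
  have Ae: "A \<in> events"
    using sigma_of_dates_subalgebra[of n r] schedule_in_range A by (auto simp: subalgebra_def)
  define a b where "a = expectation (\<lambda>x. X ?u x * indicator A x)" and "b = expectation (\<lambda>x. X ?v x * indicator A x)"
  have fub: "expectation (\<lambda>x. (LBINT s:{?u..?v}. X s x * e s) * indicator A x) =
      (LBINT s:{?u..?v}. expectation (\<lambda>x. X s x * indicator A x) * e s)"
    by (rule weighted_path_integral(2)[OF uv(1) uv(4) e_continuous Ae])
  show ?thesis
  proof (cases "?u = ?v")
    case True
    have "(LBINT s:{?u..?v}. expectation (\<lambda>x. X s x * indicator A x) * e s) = (LBINT s:{?u..?u}. expectation (\<lambda>x. X s x * indicator A x) * e s)"
      using True by simp
    also have "\<dots> = 0" 
      unfolding set_lebesgue_integral_def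
      by (rule integral_eq_zero_AE) (use AE_lborel_singleton[of ?u] in eventually_elim, simp)
    finally show ?thesis unfolding fub using True by simp
  next
    case False
    then have lt: "?u < ?v" using mono[OF j] by simp
    let ?w1 = "\<lambda>s. sinh (\<theta> * (?v - s)) / sinh (\<theta> * (?v - ?u)) * e s"
    let ?w2 = "\<lambda>s. sinh (\<theta> * (s - ?u)) / sinh (\<theta> * (?v - ?u)) * e s"
    have mean: "expectation (\<lambda>x. X s x * indicator A x) = bridge_weight (?v - s) ?u ?v * a + bridge_weight (s - ?u) ?u ?v * b"
      if s: "s \<in> {?u..?v}" for s
    proof -
      have "s \<in> {0..T}" using s uv by auto
      note iXs = integrable_X_indicator[OF this Ae]
      have iu: "integrable M (\<lambda>x. X ?u x * indicator A x)" and iv: "integrable M (\<lambda>x. X ?v x * indicator A x)"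
        using integrable_X_indicator Ae uv by auto
      have "0 = expectation (\<lambda>x. (X s x - (bridge_weight (?v - s) ?u ?v * X ?u x + bridge_weight (s - ?u) ?u ?v * X ?v x)) * indicator A x)"
        using bridge_residual_orthogonal[OF r0 rn mono j lt s A] by simp
      also have "\<dots> = expectation (\<lambda>x. X s x * indicator A x - (bridge_weight (?v - s) ?u ?v * (X ?u x * indicator A x) + bridge_weight (s - ?u) ?u ?v * (X ?v x * indicator A x)))"
        by (intro Bochner_Integration.integral_cong refl) (simp add: algebra_simps)
      also have "\<dots> = expectation (\<lambda>x. X s x * indicator A x) - (bridge_weight (?v - s) ?u ?v * a + bridge_weight (s - ?u) ?u ?v * b)"
        using iXs iu iv by (simp add: a_def b_def)
      finally show ?thesis by simp
    qed
    have "(LBINT s:{?u..?v}. expectation (\<lambda>x. X s x * indicator A x) * e s) = (LBINT s:{?u..?v}. ?w1 s * a + ?w2 s * b)"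
    proof (rule set_lebesgue_integral_cong, simp, intro allI impI)
      fix s assume "s \<in> {?u..?v}"
      show "expectation (\<lambda>x. X s x * indicator A x) * e s = ?w1 s * a + ?w2 s * b"
        unfolding mean[OF \<open>s \<in> {?u..?v}\<close>] bridge_weight_def by (simp add: distrib_left distrib_right mult_ac)
    qed
    also have "\<dots> = integral {?u..?v} (\<lambda>s. ?w1 s * a + ?w2 s * b)"
    proof (intro set_borel_integral_eq_integral borel_integrable_atLeastAtMost')
      show "continuous_on {?u..?v} (\<lambda>s. ?w1 s * a + ?w2 s * b)"
        by (intro continuous_intros e_continuous) (use lt \<theta>_pos in auto)
    qed
    also have "\<dots> = coeff_A \<theta> \<omega> e ?u ?v * a + coeff_B \<theta> \<omega> e ?u ?v * b"
      by (intro integral_unique has_integral_add has_integral_mult_left sinh_weight_integral[OF \<theta>_pos lt e e'])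
    finally show ?thesis unfolding fub a_def b_def using False by simp
  qed
qed

text \<open>Stated with the extended coefficients, it covers schedules with coinciding dates and,
  as a special case, strictly increasing ones. The function
  \<open>e\<close> enters through its differential equation, which makes the bridge weights integrate to the
  coefficients.\<close>

theorem conditional_expectation_path_integral:
  assumes n: "n \<ge> 1"
  shows "AE x in M. real_cond_exp M (sigma_of_dates M X n r) (\<lambda>y. LBINT s:{0..T}. X s y * e s) x =
    (\<Sum>j=0..n. regression_coeff_ext \<theta> \<omega> e n r j * X (r j) x)"
proof -
  let ?F = "sigma_of_dates M X n r"
  have sub: "subalgebra M ?F" by (rule sigma_of_dates_subalgebra) (rule schedule_in_range)
  interpret F: finite_measure_subalgebra M ?F
    by unfold_locales (rule sub)
  let ?A = "\<lambda>j. if r j = r (Suc j) then 0 else coeff_A \<theta> \<omega> e (r j) (r (Suc j))"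
  let ?B = "\<lambda>j. if r j = r (Suc j) then 0 else coeff_B \<theta> \<omega> e (r j) (r (Suc j))"
  have rhs: "(\<Sum>j=0..n. regression_coeff_ext \<theta> \<omega> e n r j * y j) = (\<Sum>j<n. ?A j * y j + ?B j * y (Suc j))" for y
    unfolding regression_coeff_ext_def by (rule sum_assemble_coeff[OF n])
  have iX: "integrable M (X (r j))" if "j \<le> n" for j
    by (rule X_abs_moment(1)[OF schedule_in_range[OF that]])
  show ?thesis
  proof (rule F.real_cond_exp_charact)
    show "integrable M (\<lambda>y. LBINT s:{0..T}. X s y * e s)"
      by (rule weighted_path_integral(1)[OF order_refl order_refl e_continuous])
    show "integrable M (\<lambda>x. \<Sum>j=0..n. regression_coeff_ext \<theta> \<omega> e n r j * X (r j) x)"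
      by (intro Bochner_Integration.integrable_sum integrable_mult_right iX) auto
    show "(\<lambda>x. \<Sum>j=0..n. regression_coeff_ext \<theta> \<omega> e n r j * X (r j) x) \<in> borel_measurable ?F"
      by (intro borel_measurable_sum borel_measurable_times borel_measurable_const X_measurable_sigma_of_dates) auto
    fix A assume A: "A \<in> sets ?F"
    then have Ae: "A \<in> events" using sub by (auto simp: subalgebra_def)
    have iXA: "integrable M (\<lambda>x. X (r j) x * indicator A x)" if "j \<le> n" for j
      by (rule integrable_X_indicator[OF schedule_in_range[OF that] Ae])
    have iP: "integrable M (\<lambda>x. (LBINT s:{r j..r (Suc j)}. X s x * e s) * indicator A x)" if "j < n" for j
      using weighted_path_integral(1)[OF _ _ e_continuous, of "r j" "r (Suc j)"] schedule_in_range[of j] schedule_in_range[of "Suc j"] that Ae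
      by (intro integrable_real_mult_indicator) auto
    have "(\<integral>x\<in>A. (LBINT s:{0..T}. X s x * e s) \<partial>M) = expectation (\<lambda>x. \<Sum>j<n. (LBINT s:{r j..r (Suc j)}. X s x * e s) * indicator A x)"
      unfolding set_lebesgue_integral_def[of M]
    proof (rule Bochner_Integration.integral_cong[OF refl])
      fix x assume "x \<in> space M"
      then have "continuous_on {0..T} (\<lambda>s. X s x * e s)"
        by (intro continuous_on_mult X_continuous e_continuous)
      from set_integral_schedule[OF this r0 _ mono] schedule_in_range
      have "(LBINT s:{0..T}. X s x * e s) = (\<Sum>j<n. LBINT s:{r j..r (Suc j)}. X s x * e s)"
        using rn by auto
      then show "indicat_real A x *\<^sub>R (LBINT s:{0..T}. X s x * e s) = (\<Sum>j<n. (LBINT s:{r j..r (Suc j)}. X s x * e s) * indicator A x)"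
        by (simp only: real_scaleR_def sum_distrib_left mult.commute)
    qed
    also have "\<dots> = (\<Sum>j<n. expectation (\<lambda>x. (LBINT s:{r j..r (Suc j)}. X s x * e s) * indicator A x))"
      by (rule Bochner_Integration.integral_sum) (use iP in auto)
    also have "\<dots> = (\<Sum>j<n. ?A j * expectation (\<lambda>x. X (r j) x * indicator A x) + ?B j * expectation (\<lambda>x. X (r (Suc j)) x * indicator A x))"
      by (intro sum.cong refl interval_regression[OF _ A]) auto
    also have "\<dots> = (\<Sum>j=0..n. regression_coeff_ext \<theta> \<omega> e n r j * expectation (\<lambda>x. X (r j) x * indicator A x))"
      by (rule rhs[symmetric])
    also have "\<dots> = expectation (\<lambda>x. \<Sum>j=0..n. regression_coeff_ext \<theta> \<omega> e n r j * (X (r j) x * indicator A x))"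
      using iXA by simp
    also have "\<dots> = (\<integral>x\<in>A. (\<Sum>j=0..n. regression_coeff_ext \<theta> \<omega> e n r j * X (r j) x) \<partial>M)"
      unfolding set_lebesgue_integral_def
      by (intro Bochner_Integration.integral_cong refl) (simp add: sum_distrib_left sum_distrib_right mult_ac)
    finally show "(\<integral>x\<in>A. (LBINT s:{0..T}. X s x * e s) \<partial>M) = (\<integral>x\<in>A. (\<Sum>j=0..n. regression_coeff_ext \<theta> \<omega> e n r j * X (r j) x) \<partial>M)" .
  qed
qed

end

end

section \<open>Normalization and the regression formula\<close>

lemma norm_const_b_normalizes:
  assumes "\<sigma>0 > 0" "\<omega> > 0" "T > 0"
  shows "norm_const_b \<theta> \<sigma> \<sigma>0 T \<omega> > 0"
    and "L2_norm_on T (eigfun_b \<theta> \<sigma> \<sigma>0 T \<omega>) = 1"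
    and "1 / (norm_const_b \<theta> \<sigma> \<sigma>0 T \<omega>)\<^sup>2 =
          1 / 2 * \<sigma>0\<^sup>2 * (\<sigma>\<^sup>2 - \<theta> * \<sigma>0\<^sup>2) * (1 - cos (2 * \<omega> * T))
          + 1 / 2 * \<sigma>0 ^ 4 * \<omega>\<^sup>2 * (T + sin (2 * \<omega> * T) / (2 * \<omega>))
          + 1 / 2 * (\<sigma>\<^sup>2 - \<theta> * \<sigma>0\<^sup>2)\<^sup>2 * (T - sin (2 * \<omega> * T) / (2 * \<omega>))"
proof -
  define q where "q = \<sigma>\<^sup>2 - \<theta> * \<sigma>0\<^sup>2"
  define I where "I = (LBINT s:{0..T}. (eigfun_b_raw \<theta> \<sigma> \<sigma>0 \<omega> s)\<^sup>2)"
  have raw: "eigfun_b_raw \<theta> \<sigma> \<sigma>0 \<omega> = (\<lambda>s. (\<omega> * \<sigma>0\<^sup>2) * cos (\<omega> * s) + q * sin (\<omega> * s))"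
    by (simp add: eigfun_b_raw_def q_def fun_eq_iff)
  have I: "I > 0"
    unfolding I_def raw by (rule trigonometric_square_integral_pos) (use assms in auto)
  have K: "norm_const_b \<theta> \<sigma> \<sigma>0 T \<omega> = 1 / sqrt I"
    by (simp add: norm_const_b_def L2_norm_on_def I_def)
  show "norm_const_b \<theta> \<sigma> \<sigma>0 T \<omega> > 0" using I by (simp add: K)
  have "(LBINT s:{0..T}. (eigfun_b \<theta> \<sigma> \<sigma>0 T \<omega> s)\<^sup>2) = (1 / sqrt I)\<^sup>2 * I"
    unfolding I_def eigfun_b_def K[unfolded I_def] power_mult_distrib by (rule set_integral_mult_right)
  also have "\<dots> = 1" using I by (simp add: power_divide)
  finally show "L2_norm_on T (eigfun_b \<theta> \<sigma> \<sigma>0 T \<omega>) = 1" by (simp add: L2_norm_on_def)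
  have "1 / (norm_const_b \<theta> \<sigma> \<sigma>0 T \<omega>)\<^sup>2 = I"
    unfolding K using I by (simp add: power_divide)
  also have "I = (\<omega> * \<sigma>0\<^sup>2) * q * (1 - cos (2 * \<omega> * T)) / (2 * \<omega>) + (\<omega> * \<sigma>0\<^sup>2)\<^sup>2 / 2 * (T + sin (2 * \<omega> * T) / (2 * \<omega>)) +
      q\<^sup>2 / 2 * (T - sin (2 * \<omega> * T) / (2 * \<omega>))"
    unfolding I_def raw by (rule trigonometric_square_integral) (use assms in auto)
  also have "(\<omega> * \<sigma>0\<^sup>2)\<^sup>2 / 2 = 1 / 2 * \<sigma>0 ^ 4 * \<omega>\<^sup>2"
    by (simp add: power_mult_distrib)
  also have "(\<omega> * \<sigma>0\<^sup>2) * q * (1 - cos (2 * \<omega> * T)) / (2 * \<omega>) = 1 / 2 * \<sigma>0\<^sup>2 * q * (1 - cos (2 * \<omega> * T))"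
    using assms by simp
  also have "q\<^sup>2 / 2 = 1 / 2 * q\<^sup>2" by simp
  finally show "1 / (norm_const_b \<theta> \<sigma> \<sigma>0 T \<omega>)\<^sup>2 =
          1 / 2 * \<sigma>0\<^sup>2 * (\<sigma>\<^sup>2 - \<theta> * \<sigma>0\<^sup>2) * (1 - cos (2 * \<omega> * T))
          + 1 / 2 * \<sigma>0 ^ 4 * \<omega>\<^sup>2 * (T + sin (2 * \<omega> * T) / (2 * \<omega>))
          + 1 / 2 * (\<sigma>\<^sup>2 - \<theta> * \<sigma>0\<^sup>2)\<^sup>2 * (T - sin (2 * \<omega> * T) / (2 * \<omega>))"
    unfolding q_def .
qed

lemma regression_coeff_ext_eq:
  assumes "\<And>j. j < n \<Longrightarrow> t j < t (j + 1)" "n \<ge> 1" "j \<le> n"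
  shows "regression_coeff_ext \<theta> \<omega> e n t j = regression_coeff \<theta> \<omega> e n t j"
proof -
  have "t (k - 1) \<noteq> t k" if "0 < k" "k \<le> n" for k
  proof -
    have "k - 1 < n" using that by linarith
    from assms(1)[OF this] show ?thesis using that by simp
  qed
  moreover have "t k \<noteq> t (k + 1)" if "k < n" for k
    using assms(1)[OF that] by simp
  ultimately show ?thesis
    using assms(2,3) by (simp add: regression_coeff_ext_def regression_coeff_def assemble_coeff_def)
qed

theorem mainTheorem8:
  fixes M :: "'w measure"
    and W X :: "real \<Rightarrow> 'w \<Rightarrow> real"
    and T \<theta> \<sigma> \<sigma>0 :: real
    and n d :: nat
    and t :: "nat \<Rightarrow> real"
    and \<omega> :: "nat \<Rightarrow> real"
    and e :: "nat \<Rightarrow> real \<Rightarrow> real"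
  assumes "T > 0" and "\<theta> > 0" and "\<sigma> \<ge> 0" and "\<sigma>0 \<ge> 0"
    and "prob_space M"
    and "brownian_motion_on T M W"
    and "solves_additive_sde T M W (\<lambda>x. - \<theta> * x) \<sigma> X"
    and "distr M borel (X 0) = centred_normal \<sigma>0"
    and "indep_of_process T M (X 0) W"
    and "n \<ge> 1" and "d \<ge> 1"
    and "t 0 = 0" and "t n = T" and "\<And>j. j < n \<Longrightarrow> t j < t (j + 1)"
    and "increasing_enumeration \<omega> (freqs \<theta> \<sigma> \<sigma>0 T)"
    and "\<And>i. i \<ge> 1 \<Longrightarrow> e i = eigfun \<theta> \<sigma> \<sigma>0 T (\<omega> i)"
  shows
    \<comment> \<open>value of the normalization constant in case (b)\<close>
    "(\<sigma>0 > 0 \<longrightarrow> (\<forall>i\<ge>1.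
        norm_const_b \<theta> \<sigma> \<sigma>0 T (\<omega> i) > 0 \<and>
        L2_norm_on T (e i) = 1 \<and>
        1 / (norm_const_b \<theta> \<sigma> \<sigma>0 T (\<omega> i))\<^sup>2 =
          1 / 2 * \<sigma>0\<^sup>2 * (\<sigma>\<^sup>2 - \<theta> * \<sigma>0\<^sup>2) * (1 - cos (2 * \<omega> i * T))
          + 1 / 2 * \<sigma>0 ^ 4 * (\<omega> i)\<^sup>2 * (T + sin (2 * \<omega> i * T) / (2 * \<omega> i))
          + 1 / 2 * (\<sigma>\<^sup>2 - \<theta> * \<sigma>0\<^sup>2)\<^sup>2 * (T - sin (2 * \<omega> i * T) / (2 * \<omega> i))))
     \<and>
     (\<forall>i\<in>{1..d}. AE x in M.
        real_cond_exp M (sigma_of_dates M X n t) (\<lambda>y. LBINT s:{0..T}. X s y * e i s) x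
          = (\<Sum>j=0..n. regression_coeff \<theta> (\<omega> i) (e i) n t j * X (t j) x))
     \<and>
     \<comment> \<open>cancellation of the derivative terms in the inner coefficients\<close>
     (\<forall>i\<in>{1..d}. \<forall>j\<in>{1..<n}.
        regression_coeff \<theta> (\<omega> i) (e i) n t j =
          (let h = t (j + 1) - t j; h' = t j - t (j - 1) in
            - \<theta> / (\<theta>\<^sup>2 + (\<omega> i)\<^sup>2) *
              (2 * e i (t (j + 1)) / (exp (\<theta> * h) - exp (- \<theta> * h))
               - e i (t j) * ((exp (\<theta> * h) + exp (- \<theta> * h)) / (exp (\<theta> * h) - exp (- \<theta> * h))))
            + \<theta> / (\<theta>\<^sup>2 + (\<omega> i)\<^sup>2) *
              (e i (t j) * ((exp (\<theta> * h') + exp (- \<theta> * h')) / (exp (\<theta> * h') - exp (- \<theta> * h')))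
               - 2 * e i (t (j - 1)) / (exp (\<theta> * h') - exp (- \<theta> * h')))))
     \<and>
     (\<sigma>0 = 0 \<longrightarrow> (\<forall>i\<in>{1..d}.
        (\<forall>j<n. ((\<lambda>v. coeff_A \<theta> (\<omega> i) (e i) (t j) v) \<longlongrightarrow> 0) (at_right (t j))) \<and>
        (\<forall>j\<in>{1..n}. ((\<lambda>u. coeff_B \<theta> (\<omega> i) (e i) u (t j)) \<longlongrightarrow> 0) (at_left (t j))) \<and>
        \<comment> \<open>resulting formula for schedules in which some dates may be equal\<close>
        (\<forall>r :: nat \<Rightarrow> real. r 0 = 0 \<and> r n = T \<and> (\<forall>j<n. r j \<le> r (j + 1)) \<longrightarrow>
          (AE x in M.
            real_cond_exp M (sigma_of_dates M X n r) (\<lambda>y. LBINT s:{0..T}. X s y * e i s) x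
              = (\<Sum>j=0..n. regression_coeff_ext \<theta> (\<omega> i) (e i) n r j * X (r j) x)))))"

proof -
  interpret ornstein_uhlenbeck M T \<theta> \<sigma> \<sigma>0 W X
    by (intro ornstein_uhlenbeck.intro ornstein_uhlenbeck_axioms.intro assms)
  have \<omega>_pos: "\<omega> i > 0" if "i \<ge> 1" for i
  proof -
    have "\<omega> i \<in> freqs \<theta> \<sigma> \<sigma>0 T"
      using assms(15) that by (auto simp: increasing_enumeration_def)
    then show ?thesis by (auto simp: freqs_def freqs_a_def freqs_b_def split: if_splits)
  qed
  have derivs: "(e i has_real_derivative deriv (e i) s) (at s)"
    "(deriv (e i) has_real_derivative - ((\<omega> i)\<^sup>2 * e i s)) (at s)" if "i \<ge> 1" for i s
  proof -
    obtain p q where "eigfun \<theta> \<sigma> \<sigma>0 T (\<omega> i) = (\<lambda>s. p * cos (\<omega> i * s) + q * sin (\<omega> i * s))"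
      by (rule eigfun_trigonometric)
    then have ei: "e i = (\<lambda>s. p * cos (\<omega> i * s) + q * sin (\<omega> i * s))"
      using assms(16)[OF that] by simp
    have dei: "deriv (e i) = (\<lambda>s. \<omega> i * (q * cos (\<omega> i * s) - p * sin (\<omega> i * s)))"
      unfolding ei by (rule ext) (rule DERIV_imp_deriv[OF trigonometric_derivs(1)])
    show "(e i has_real_derivative deriv (e i) s) (at s)"
      unfolding dei unfolding ei by (rule trigonometric_derivs(1))
    show "(deriv (e i) has_real_derivative - ((\<omega> i)\<^sup>2 * e i s)) (at s)"
      unfolding dei unfolding ei by (rule trigonometric_derivs(2))
  qed
  have degenerate: "AE x in M.
        real_cond_exp M (sigma_of_dates M X n r) (\<lambda>y. LBINT s:{0..T}. X s y * e i s) x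
          = (\<Sum>j=0..n. regression_coeff_ext \<theta> (\<omega> i) (e i) n r j * X (r j) x)"
    if "i \<ge> 1" "r 0 = 0" "r n = T" "\<And>j. j < n \<Longrightarrow> r j \<le> r (Suc j)" for i and r :: "nat \<Rightarrow> real"
    by (rule conditional_expectation_path_integral[OF that(2-4) derivs[OF that(1)] \<open>n \<ge> 1\<close>])
  have strict: "AE x in M.
        real_cond_exp M (sigma_of_dates M X n t) (\<lambda>y. LBINT s:{0..T}. X s y * e i s) x
          = (\<Sum>j=0..n. regression_coeff \<theta> (\<omega> i) (e i) n t j * X (t j) x)"
    if "i \<ge> 1" for i
  proof -
    have "(\<Sum>j=0..n. regression_coeff \<theta> (\<omega> i) (e i) n t j * X (t j) x) =
        (\<Sum>j=0..n. regression_coeff_ext \<theta> (\<omega> i) (e i) n t j * X (t j) x)" for x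
      using regression_coeff_ext_eq[of n t, OF assms(14) \<open>n \<ge> 1\<close>] by (intro sum.cong refl) simp
    moreover have "t j \<le> t (Suc j)" if "j < n" for j
      using assms(14)[OF that] by simp
    ultimately show ?thesis
      using degenerate[OF that assms(12,13)] by (simp only:)
  qed
  have limit_A: "((\<lambda>v. coeff_A \<theta> (\<omega> i) (e i) (t j) v) \<longlongrightarrow> 0) (at_right (t j))" if "i \<ge> 1" for i j
    by (rule tendsto_within_subset[OF coeff_A_limit[OF \<theta>_pos derivs(1)[OF that]]]) simp
  have limit_B: "((\<lambda>u. coeff_B \<theta> (\<omega> i) (e i) u (t j)) \<longlongrightarrow> 0) (at_left (t j))" if "i \<ge> 1" for i j
    by (rule tendsto_within_subset[OF coeff_B_limit[OF \<theta>_pos derivs(1)[OF that]]]) simp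
  show ?thesis
  proof (intro conjI impI allI ballI)
    fix i :: nat assume \<sigma>0: "\<sigma>0 > 0" and i: "i \<ge> 1"
    have ei: "e i = eigfun_b \<theta> \<sigma> \<sigma>0 T (\<omega> i)" using assms(16)[OF i] \<sigma>0 by (simp add: eigfun_def)
    note norm = norm_const_b_normalizes[OF \<sigma>0 \<omega>_pos[OF i] \<open>T > 0\<close>]
    show "norm_const_b \<theta> \<sigma> \<sigma>0 T (\<omega> i) > 0" by (rule norm(1))
    show "L2_norm_on T (e i) = 1" unfolding ei by (rule norm(2))
    show "1 / (norm_const_b \<theta> \<sigma> \<sigma>0 T (\<omega> i))\<^sup>2 =
          1 / 2 * \<sigma>0\<^sup>2 * (\<sigma>\<^sup>2 - \<theta> * \<sigma>0\<^sup>2) * (1 - cos (2 * \<omega> i * T))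
          + 1 / 2 * \<sigma>0 ^ 4 * (\<omega> i)\<^sup>2 * (T + sin (2 * \<omega> i * T) / (2 * \<omega> i))
          + 1 / 2 * (\<sigma>\<^sup>2 - \<theta> * \<sigma>0\<^sup>2)\<^sup>2 * (T - sin (2 * \<omega> i * T) / (2 * \<omega> i))"
      by (rule norm(3))
  next
    fix i j assume i: "i \<in> {1..d}" and j: "j \<in> {1..<n}"
    then show "regression_coeff \<theta> (\<omega> i) (e i) n t j =
          (let h = t (j + 1) - t j; h' = t j - t (j - 1) in
            - \<theta> / (\<theta>\<^sup>2 + (\<omega> i)\<^sup>2) *
              (2 * e i (t (j + 1)) / (exp (\<theta> * h) - exp (- \<theta> * h))
               - e i (t j) * ((exp (\<theta> * h) + exp (- \<theta> * h)) / (exp (\<theta> * h) - exp (- \<theta> * h))))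
            + \<theta> / (\<theta>\<^sup>2 + (\<omega> i)\<^sup>2) *
              (e i (t j) * ((exp (\<theta> * h') + exp (- \<theta> * h')) / (exp (\<theta> * h') - exp (- \<theta> * h')))
               - 2 * e i (t (j - 1)) / (exp (\<theta> * h') - exp (- \<theta> * h'))))"
      by (simp add: regression_coeff_def assemble_coeff_def coeff_A_def coeff_B_def Let_def)
  next
    fix i assume "i \<in> {1..d}"
    then have i: "i \<ge> 1" by simp
    show "AE x in M.
        real_cond_exp M (sigma_of_dates M X n t) (\<lambda>y. LBINT s:{0..T}. X s y * e i s) x
          = (\<Sum>j=0..n. regression_coeff \<theta> (\<omega> i) (e i) n t j * X (t j) x)"
      by (rule strict[OF i])
    fix j :: nat
    show "((\<lambda>v. coeff_A \<theta> (\<omega> i) (e i) (t j) v) \<longlongrightarrow> 0) (at_right (t j))"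
      by (rule limit_A[OF i])
    show "((\<lambda>u. coeff_B \<theta> (\<omega> i) (e i) u (t j)) \<longlongrightarrow> 0) (at_left (t j))"
      by (rule limit_B[OF i])
  next
    fix i and r :: "nat \<Rightarrow> real"
    assume "i \<in> {1..d}" and r: "r 0 = 0 \<and> r n = T \<and> (\<forall>j<n. r j \<le> r (j + 1))"
    then have i: "i \<ge> 1" by simp
    have mono: "r j \<le> r (Suc j)" if "j < n" for j using r that by simp
    show "AE x in M.
        real_cond_exp M (sigma_of_dates M X n r) (\<lambda>y. LBINT s:{0..T}. X s y * e i s) x
          = (\<Sum>j=0..n. regression_coeff_ext \<theta> (\<omega> i) (e i) n r j * X (r j) x)"
      by (rule degenerate[OF i conjunct1[OF r] conjunct1[OF conjunct2[OF r]] mono])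
  qed
qed

end
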